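(* Let $G$ be a countable amenable group, let $k$ be a positive integer, and let $(X,G)$ be a symbolic dynamical system over a finite alphabet. Suppose that the topological entropy of $X$ satisfies $h(X)>\log k$ and that $(X,G)$ has the gluing property. Then there exists a symbolic dynamical system $(\tilde{X},G)$ (over some finite alphabet) such that $(\tilde{X},G)$ is an extension of $(X,G)$, $h(\tilde{X})=h(X)$, and $(\tilde{X},G)$ factors onto the full $G$-shift over $k$ symbols.
   Context: Amenability: a countable group $G$ is amenable if there is a sequence $(F_n)$ of (nonempty) finite subsets of $G$ (a Følner sequence) such that for every $g\in G$, $\lim_{n\to\infty}\frac{|gF_n\bigtriangleup F_n|}{|F_n|}=0$, where $|\cdot|$ is cardinality and $\bigtriangleup$ is symmetric difference. Symbolic systems: for a finite set $\Lambda$, the full $G$-shift over $\Lambda$ is the space $\Lambda^G$ with the product topology (with $\Lambda$ discrete) and the action of $G$ given by $(gx)(h)=x(hg)$. The full $G$-shift over $k$ symbols is the case $\Lambda=\{1,\dots,k\}$. A symbolic dynamical system over $\Lambda$, denoted $(X,G)$, is a closed subset $X\subset\Lambda^G$ invariant under this action, with the restricted action. Blocks: for a finite set $T\subset G$, a block with domain $T$ is a map $B:T\to\Lambda$. For $x\in\Lambda^G$, $x(T)$ denotes the block with domain $T$ given by $t\mapsto x(t)$. A block $B$ with domain $T$ occurs in $X$ if $x(T)=B$ for some $x\in X$. Let $\mathcal{N}_T(X)$ denote the number of blocks with domain $T$ occurring in $X$. Entropy: $h(X)=\lim_{n\to\infty}\frac{1}{|F_n|}\log \mathcal{N}_{F_n}(X)$,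 where $\log$ is the logarithm with base $2$ and $(F_n)$ is a Følner sequence in $G$; this limit exists and does not depend on the choice of the Følner sequence. Gluing property: $(X,G)$ has the gluing property if there exists a finite set $D\subset G$ containing the neutral element such that for any finite subsets $T_1,T_2\subset G$ with $T_2\cap DT_1=\varnothing$ (where $DT_1=\{dt: d\in D,\ t\in T_1\}$), and any two blocks $A$ and $B$ occurring in $X$, with domains $T_1$ and $T_2$ respectively, there exists $x\in X$ such that $x(T_1)=A$ and $x(T_2)=B$. Extensions and factors: $(Y,G)$ factors onto $(Z,G)$ (equivalently, $(Y,G)$ is an extension of $(Z,G)$) if there is a continuous surjective map $\pi:Y\to Z$ with $\pi(gy)=g\pi(y)$ for all $g\in G$, $y\in Y$.
   Formalization: "Countable group" is taken to mean countably infinite: for finite G the claim fails, e.g. G = Z/2, k = 2, X the five constant configurations over five symbols, where any extension of equal entropy has only fixed points and cannot factor onto the full 2-shift. *)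

theory Defs
  imports "HOL-Analysis.Analysis" "HOL-Algebra.Coset"
begin

definition folner_sequence :: "('g, 'm) monoid_scheme \<Rightarrow> (nat \<Rightarrow> 'g set) \<Rightarrow> bool" where
  "folner_sequence G F \<longleftrightarrow>
     (\<forall>n. F n \<subseteq> carrier G \<and> finite (F n) \<and> F n \<noteq> {}) \<and>
     (\<forall>g\<in>carrier G.
        (\<lambda>n. real (card (sym_diff (g <#\<^bsub>G\<^esub> F n) (F n))) / real (card (F n))) \<longlonglongrightarrow> 0)"

definition amenable :: "('g, 'm) monoid_scheme \<Rightarrow> bool" where
  "amenable G \<longleftrightarrow> (\<exists>F. folner_sequence G F)"

text \<open>
  Configurations are represented as elements of \<open>carrier G \<rightarrow>\<^sub>E \<Lambda>\<close>, that is, functions with the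
  value \<open>undefined\<close> outside the carrier.
\<close>

definition full_shift :: "('g, 'm) monoid_scheme \<Rightarrow> 'a set \<Rightarrow> ('g \<Rightarrow> 'a) set" where
  "full_shift G \<Lambda> = carrier G \<rightarrow>\<^sub>E \<Lambda>"

definition shift_topology :: "('g, 'm) monoid_scheme \<Rightarrow> 'a set \<Rightarrow> ('g \<Rightarrow> 'a) topology" where
  "shift_topology G \<Lambda> = product_topology (\<lambda>_. discrete_topology \<Lambda>) (carrier G)"

definition shift :: "('g, 'm) monoid_scheme \<Rightarrow> 'g \<Rightarrow> ('g \<Rightarrow> 'a) \<Rightarrow> 'g \<Rightarrow> 'a" where
  "shift G g x = (\<lambda>h\<in>carrier G. x (h \<otimes>\<^bsub>G\<^esub> g))"

definition symbolic_system ::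
    "('g, 'm) monoid_scheme \<Rightarrow> 'a set \<Rightarrow> ('g \<Rightarrow> 'a) set \<Rightarrow> bool" where
  "symbolic_system G \<Lambda> X \<longleftrightarrow>
     finite \<Lambda> \<and> closedin (shift_topology G \<Lambda>) X \<and>
     (\<forall>g\<in>carrier G. \<forall>x\<in>X. shift G g x \<in> X)"

text \<open>The blocks with domain \<open>T\<close> occurring in \<open>X\<close>; a block is \<open>undefined\<close> outside its domain.\<close>

definition occurring_blocks :: "'g set \<Rightarrow> ('g \<Rightarrow> 'a) set \<Rightarrow> ('g \<Rightarrow> 'a) set" where
  "occurring_blocks T X = (\<lambda>x. restrict x T) ` X"

text \<open>
  The common limit along all Folner sequences; for an amenable group and a nonempty system it
  exists by the Ornstein--Weiss lemma, and it is unique because a Folner sequence exists.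
  For empty \<open>X\<close> the value is 0, since \<open>log 2 0 = 0\<close>.
\<close>

definition entropy :: "('g, 'm) monoid_scheme \<Rightarrow> ('g \<Rightarrow> 'a) set \<Rightarrow> real" where
  "entropy G X =
     (THE h. \<forall>F. folner_sequence G F \<longrightarrow>
        (\<lambda>n. log 2 (real (card (occurring_blocks (F n) X))) / real (card (F n))) \<longlonglongrightarrow> h)"

definition gluing_property :: "('g, 'm) monoid_scheme \<Rightarrow> ('g \<Rightarrow> 'a) set \<Rightarrow> bool" where
  "gluing_property G X \<longleftrightarrow>
     (\<exists>D. D \<subseteq> carrier G \<and> finite D \<and> \<one>\<^bsub>G\<^esub> \<in> D \<and>
        (\<forall>T1 T2. T1 \<subseteq> carrier G \<and> finite T1 \<and> T2 \<subseteq> carrier G \<and> finite T2 \<and>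
             T2 \<inter> (D <#>\<^bsub>G\<^esub> T1) = {} \<longrightarrow>
           (\<forall>A\<in>occurring_blocks T1 X. \<forall>B\<in>occurring_blocks T2 X.
              \<exists>x\<in>X. restrict x T1 = A \<and> restrict x T2 = B)))"

text \<open>The system \<open>Y\<close> over \<open>\<Lambda>\<close> factors onto the system \<open>Z\<close> over \<open>\<Delta>\<close>, i.e. \<open>Y\<close> is an extension of \<open>Z\<close>.\<close>

definition factors_onto ::
    "('g, 'm) monoid_scheme \<Rightarrow> 'a set \<Rightarrow> ('g \<Rightarrow> 'a) set \<Rightarrow> 'b set \<Rightarrow> ('g \<Rightarrow> 'b) set \<Rightarrow> bool" where
  "factors_onto G \<Lambda> Y \<Delta> Z \<longleftrightarrow>
     (\<exists>\<pi>. continuous_map (subtopology (shift_topology G \<Lambda>) Y) (subtopology (shift_topology G \<Delta>) Z) \<pi> \<and>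
          \<pi> ` Y = Z \<and>
          (\<forall>g\<in>carrier G. \<forall>y\<in>Y. \<pi> (shift G g y) = shift G g (\<pi> y)))"

end

theory Submission
  imports Defs "HOL-Real_Asymp.Real_Asymp"
begin

text \<open>
  The extension can be taken to be a disjoint union. Suppose that \<open>X\<close> contains a nonempty subsystem \<open>Z\<close> with
  \<open>h(Z) < h(X) - log k\<close>, and let \<open>X'\<close> be the disjoint union of \<open>X\<close> and \<open>Z \<times> {1..k}\<^sup>G\<close>. Then \<open>X'\<close> maps
  onto \<open>X\<close>, by the identity on the first part and the projection to \<open>Z\<close> on the second; it maps onto the
  full shift, by a constant on the first part and the projection on the second; and its entropy is
  the maximum of \<open>h(X)\<close> and \<open>h(Z) + log k\<close>, that is, \<open>h(X)\<close>. This is \<open>tagged_union\<close> together with the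
  final proof.

  It remains to find subsystems of arbitrarily small entropy, and this is what the gluing property is
  used for (\<open>low_entropy_subsystem\<close>). By Shearer's inequality, \<open>log N(E) \<le> (|set_inv T <#> E| / |T|) log N(T)\<close>
  for finite sets \<open>T \<noteq> {}\<close> and \<open>E\<close>, where \<open>N\<close> counts blocks (\<open>block_count_shearer\<close>). So the entropy exists
  and is bounded by \<open>log N(T) / |T|\<close> for every single \<open>T\<close>, and it suffices to decrease such quotients
  by a constant factor (\<open>low_entropy_step\<close>). Given a subsystem \<open>Z\<close>, choose a point \<open>z\<close> of \<open>Z\<close> and a large
  Folner set \<open>S\<close>. A maximal family of translates of \<open>S\<close> in which each has a private half covers
  at least half of the group (\<open>half_cover\<close>). Each translate overlaps with boundedly many others, so
  the family splits into polynomially many classes of separated translates, and the gluing property allows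
  a fixed pattern to be written on all translates, class after class (\<open>overwrite_tiles\<close>). In a
  large window, the new point is determined by its values on the boundaries of the tiles, by the
  uncovered part of a point of \<open>Z\<close>, and by the position and class of every tile. The first
  and the last contribution are negligible when \<open>S\<close> is large and nearly invariant; the second costs half the
  entropy of \<open>Z\<close>, since Shearer's inequality applies to the uncovered part of the
  window whatever its shape. The points whose windows all look like windows of this new point
  form the required subsystem.
\<close>

section \<open>Shearer's inequality for block counts\<close>

text \<open>
  Hoelder's inequality for \<open>m\<close> factors with all exponents \<open>1 / m\<close>, where \<open>m\<close> is the number of
  factors, cleared of roots. The constant \<open>c\<close> absorbs the coordinates that are not split up in the
  inductive proof of Shearer's inequality.
\<close>
lemma power_sum_le_prod_sum:
  fixes b :: "'i \<Rightarrow> 'c \<Rightarrow> real" and f :: "'c \<Rightarrow> real"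
  assumes "finite A" "finite J" "card J > 0"
    and b: "\<And>i a. i \<in> J \<Longrightarrow> a \<in> A \<Longrightarrow> b i a \<ge> 0"
    and f: "\<And>a. a \<in> A \<Longrightarrow> f a \<ge> 0"
    and c: "c \<ge> 0"
    and le: "\<And>a. a \<in> A \<Longrightarrow> f a ^ card J \<le> c * (\<Prod>i\<in>J. b i a)"
  shows "(\<Sum>a\<in>A. f a) ^ card J \<le> c * (\<Prod>i\<in>J. \<Sum>a\<in>A. b i a)"
proof (cases "\<exists>i\<in>J. (\<Sum>a\<in>A. b i a) = 0")
  case True
  then obtain i where i: "i \<in> J" "(\<Sum>a\<in>A. b i a) = 0" by blast
  have "f a = 0" if "a \<in> A" for a
  proof -
    have "b i a = 0" using i b that \<open>finite A\<close> by (simp add: sum_nonneg_eq_0_iff)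
    then have "(\<Prod>i\<in>J. b i a) = 0" using i \<open>finite J\<close> by auto
    then have "f a ^ card J \<le> 0" using le[OF that] by simp
    then show ?thesis using f[OF that] by (metis not_le order_antisym_conv zero_less_power)
  qed
  then have "(\<Sum>a\<in>A. f a) = 0" by simp
  moreover have "0 \<le> c * (\<Prod>i\<in>J. \<Sum>a\<in>A. b i a)"
    by (intro mult_nonneg_nonneg c prod_nonneg ballI sum_nonneg b) auto
  ultimately show ?thesis using assms(3) by (simp add: power_0_left)
next
  case False
  define m where "m = card J"
  have m: "m > 0" using assms by (simp add: m_def)
  have J: "J \<noteq> {}" using assms by auto
  define B where "B i = (\<Sum>a\<in>A. b i a)" for i
  have B0: "B i \<ge> 0" if "i \<in> J" for i unfolding B_def using b that by (intro sum_nonneg)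
  have B: "B i > 0" if "i \<in> J" for i using False B0[OF that] that unfolding B_def by force
  define P where "P = (c * (\<Prod>i\<in>J. B i)) powr (1/m)"
  have PB: "(\<Prod>i\<in>J. B i) > 0" using B by (intro prod_pos) auto
  \<comment> \<open>After normalising each \<open>b i\<close> to total mass 1, the arithmetic-geometric mean inequality at
    each \<open>a\<close> bounds \<open>f a\<close> by an average of masses.\<close>
  have fa: "f a \<le> P * (\<Sum>i\<in>J. b i a / B i / m)" if a: "a \<in> A" for a
  proof -
    have "f a = (f a ^ m) powr (1/m)"
      using f[OF a] m real_root_power_cancel[of m "f a"] by (simp add: root_powr_inverse)
    also have "\<dots> \<le> (c * (\<Prod>i\<in>J. b i a)) powr (1/m)"
      using le[OF a] f[OF a] by (intro powr_mono2) (auto simp: m_def)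
    also have "c * (\<Prod>i\<in>J. b i a) = (c * (\<Prod>i\<in>J. B i)) * (\<Prod>i\<in>J. b i a / B i)"
      using PB by (simp add: prod_dividef)
    also have "\<dots> powr (1/m) = P * (\<Prod>i\<in>J. b i a / B i) powr (1/m)"
      unfolding P_def by (rule powr_mult)
    also have "\<dots> \<le> P * (\<Sum>i\<in>J. b i a / B i / m)"
      unfolding m_def using B0 b a \<open>finite J\<close> J
      by (intro mult_left_mono arith_geom_mean) (auto simp: P_def)
    finally show ?thesis .
  qed
  have "(\<Sum>a\<in>A. f a) \<le> (\<Sum>a\<in>A. P * (\<Sum>i\<in>J. b i a / B i / m))" by (intro sum_mono fa)
  also have "\<dots> = P * (\<Sum>i\<in>J. \<Sum>a\<in>A. b i a / B i / m)"
    by (subst sum.swap) (simp add: sum_distrib_left)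
  also have "(\<Sum>i\<in>J. \<Sum>a\<in>A. b i a / B i / m) = (\<Sum>i\<in>J. 1 / m)"
  proof (intro sum.cong refl)
    fix i assume i: "i \<in> J"
    have "(\<Sum>a\<in>A. b i a / B i / m) = B i / B i / m"
      unfolding sum_divide_distrib[symmetric] by (simp add: B_def)
    then show "(\<Sum>a\<in>A. b i a / B i / m) = 1 / m" using B[OF i] by simp
  qed
  also have "\<dots> = 1" using m by (simp add: m_def)
  finally have "(\<Sum>a\<in>A. f a) \<le> P" by simp
  then have "(\<Sum>a\<in>A. f a) ^ m \<le> P ^ m" using f by (intro power_mono sum_nonneg) auto
  also have "P ^ m = c * (\<Prod>i\<in>J. B i)"
    using m c PB by (simp add: P_def powr_powr flip: powr_realpow')
  finally show ?thesis by (simp add: m_def B_def)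
qed

lemma finite_occurring_blocks:
  assumes "finite T" "finite \<Lambda>" "\<And>x v. x \<in> X \<Longrightarrow> v \<in> T \<Longrightarrow> x v \<in> \<Lambda>"
  shows "finite (occurring_blocks T X)" "card (occurring_blocks T X) \<le> card \<Lambda> ^ card T"
proof -
  have sub: "occurring_blocks T X \<subseteq> T \<rightarrow>\<^sub>E \<Lambda>"
    using assms(3) by (auto simp: occurring_blocks_def)
  have fin: "finite (T \<rightarrow>\<^sub>E \<Lambda>)" using assms by (intro finite_PiE) auto
  show "finite (occurring_blocks T X)" using sub fin by (rule finite_subset)
  show "card (occurring_blocks T X) \<le> card \<Lambda> ^ card T"
    using card_mono[OF fin sub] assms by (simp add: card_PiE)
qed

lemma card_occurring_blocks_mono:
  assumes "T \<subseteq> T'" "finite (occurring_blocks T' X)"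
  shows "card (occurring_blocks T X) \<le> card (occurring_blocks T' X)"
proof -
  have "occurring_blocks T X = (\<lambda>b. restrict b T) ` occurring_blocks T' X"
    using assms(1) by (auto simp: occurring_blocks_def image_image restrict_restrict Int_absorb1)
  then show ?thesis using assms(2) by (simp add: card_image_le)
qed

lemma occurring_blocks_mono: "X \<subseteq> Y \<Longrightarrow> occurring_blocks T X \<subseteq> occurring_blocks T Y"
  by (auto simp: occurring_blocks_def)

text \<open>
  Sorting the configurations by their symbol at \<open>v\<close> sorts the blocks, and within one class the
  coordinate \<open>v\<close> carries no information.
\<close>
lemma card_occurring_blocks_split:
  assumes v: "v \<in> T" and fin: "finite \<Lambda>" "finite T" and X: "\<And>x u. x \<in> X \<Longrightarrow> u \<in> T \<Longrightarrow> x u \<in> \<Lambda>"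
  shows "card (occurring_blocks T X) = (\<Sum>a\<in>\<Lambda>. card (occurring_blocks (T - {v}) {x\<in>X. x v = a}))"
proof -
  have un: "occurring_blocks T X = (\<Union>a\<in>\<Lambda>. occurring_blocks T {x\<in>X. x v = a})"
    using X v by (auto simp: occurring_blocks_def)
  have finX: "finite (occurring_blocks T {x\<in>X. x v = a})" for a
    using X by (intro finite_occurring_blocks[OF fin(2,1)]) auto
  have "card (occurring_blocks T X) = (\<Sum>a\<in>\<Lambda>. card (occurring_blocks T {x\<in>X. x v = a}))"
    unfolding un
  proof (rule card_UN_disjoint)
    show "\<forall>i\<in>\<Lambda>. \<forall>j\<in>\<Lambda>. i \<noteq> j \<longrightarrow>
       occurring_blocks T {x \<in> X. x v = i} \<inter> occurring_blocks T {x \<in> X. x v = j} = {}"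
    proof (intro ballI impI equals0I)
      fix i j b assume ij: "i \<noteq> j"
        and "b \<in> occurring_blocks T {x \<in> X. x v = i} \<inter> occurring_blocks T {x \<in> X. x v = j}"
      then obtain x y where "b = restrict x T" "x v = i" "b = restrict y T" "y v = j"
        unfolding occurring_blocks_def by blast
      then have "b v = i" "b v = j" using v by (metis restrict_apply')+
      with ij show False by simp
    qed
  qed (use fin finX in auto)
  also have "\<dots> = (\<Sum>a\<in>\<Lambda>. card (occurring_blocks (T - {v}) {x\<in>X. x v = a}))"
  proof (rule sum.cong[OF refl])
    fix a
    let ?r = "\<lambda>b. restrict b (T - {v})"
    have "occurring_blocks (T - {v}) {x\<in>X. x v = a} = ?r ` occurring_blocks T {x\<in>X. x v = a}"
      by (auto simp: occurring_blocks_def image_image restrict_restrict Int_absorb1)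
    moreover have "inj_on ?r (occurring_blocks T {x\<in>X. x v = a})"
    proof (rule inj_onI)
      fix b b' assume b: "b \<in> occurring_blocks T {x\<in>X. x v = a}" "b' \<in> occurring_blocks T {x\<in>X. x v = a}"
        and eq: "?r b = ?r b'"
      obtain x y where xy: "b = restrict x T" "x v = a" "b' = restrict y T" "y v = a"
        using b unfolding occurring_blocks_def by blast
      have "x u = y u" if "u \<in> T" for u
        using xy that fun_cong[OF eq, of u] by (cases "u = v") auto
      then show "b = b'" unfolding xy by (rule restrict_ext)
    qed
    ultimately show "card (occurring_blocks T {x\<in>X. x v = a}) = card (occurring_blocks (T - {v}) {x\<in>X. x v = a})"
      by (simp add: card_image)
  qed
  finally show ?thesis .
qed

lemma occurring_blocks_empty_domain: "X \<noteq> {} \<Longrightarrow> occurring_blocks {} X = {\<lambda>_. undefined}"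
  by (auto simp: occurring_blocks_def restrict_def image_iff)

text \<open>
  The Chung--Graham--Frankl--Shearer inequality: if every point of \<open>E\<close> lies in at least \<open>m\<close> of the
  sets \<open>S i\<close>, then the \<open>m\<close>-th power of the number of blocks on \<open>E\<close> is at most the product of the
  numbers of blocks on the traces \<open>S i \<inter> E\<close>. The induction removes one point \<open>v\<close> of \<open>E\<close>: for each
  symbol at \<open>v\<close> the induction hypothesis applies to the configurations with that symbol, and the
  resulting bounds are summed by Hoelder's inequality over \<open>m\<close> of the sets that contain \<open>v\<close>.
\<close>
lemma shearer:
  fixes X :: "('g \<Rightarrow> 'l) set"
  assumes "finite E" "finite \<Lambda>" "finite I" "m > 0"
    and X: "\<And>x v. x \<in> X \<Longrightarrow> v \<in> E \<Longrightarrow> x v \<in> \<Lambda>"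
    and cover: "\<And>v. v \<in> E \<Longrightarrow> m \<le> card {i\<in>I. v \<in> S i}"
  shows "card (occurring_blocks E X) ^ m \<le> (\<Prod>i\<in>I. card (occurring_blocks (S i \<inter> E) X))"
  using assms(1) X cover
proof (induction E arbitrary: X rule: finite_induct)
  case empty
  show ?case
  proof (cases "X = {}")
    case True then show ?thesis using \<open>m > 0\<close> by (simp add: occurring_blocks_def power_0_left)
  next
    case False then show ?thesis by (simp add: occurring_blocks_empty_domain)
  qed
next
  case (insert v E)
  let ?N = "\<lambda>T X. real (card (occurring_blocks T X))"
  let ?E = "insert v E" and ?X = "\<lambda>a. {x\<in>X. x v = a}"
  obtain J where J: "J \<subseteq> {i\<in>I. v \<in> S i}" "card J = m"
    using insert.prems(2)[of v] by (metis insertI1 obtain_subset_with_card_n)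
  have finJ: "finite J" using J \<open>m > 0\<close> card_ge_0_finite by blast
  have JI: "J \<subseteq> I" using J by auto
  have fin: "finite (occurring_blocks (T \<inter> ?E) X')" if "X' \<subseteq> X" for T X'
    using that insert.prems(1) insert.hyps
    by (intro finite_occurring_blocks[OF _ \<open>finite \<Lambda>\<close>]) auto
  have IH: "real (card (occurring_blocks E (?X a))) ^ m \<le> (\<Prod>i\<in>I. ?N (S i \<inter> E) (?X a))" for a
  proof -
    have "card (occurring_blocks E (?X a)) ^ m \<le> (\<Prod>i\<in>I. card (occurring_blocks (S i \<inter> E) (?X a)))"
      using insert.prems by (intro insert.IH) auto
    then have "real (card (occurring_blocks E (?X a)) ^ m) \<le> real (\<Prod>i\<in>I. card (occurring_blocks (S i \<inter> E) (?X a)))"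
      by (rule of_nat_mono)
    then show ?thesis by simp
  qed
  have "(\<Sum>a\<in>\<Lambda>. ?N E (?X a)) ^ card J
      \<le> (\<Prod>i\<in>I - J. ?N (S i \<inter> ?E) X) * (\<Prod>i\<in>J. \<Sum>a\<in>\<Lambda>. ?N (S i \<inter> E) (?X a))"
  proof (rule power_sum_le_prod_sum)
    fix a assume "a \<in> \<Lambda>"
    have "?N E (?X a) ^ card J \<le> (\<Prod>i\<in>I. ?N (S i \<inter> E) (?X a))" using IH J by simp
    also have "\<dots> = (\<Prod>i\<in>I - J. ?N (S i \<inter> E) (?X a)) * (\<Prod>i\<in>J. ?N (S i \<inter> E) (?X a))"
      by (rule prod.subset_diff[OF JI \<open>finite I\<close>])
    also have "\<dots> \<le> (\<Prod>i\<in>I - J. ?N (S i \<inter> ?E) X) * (\<Prod>i\<in>J. ?N (S i \<inter> E) (?X a))"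
    proof (intro mult_right_mono prod_mono conjI of_nat_mono prod_nonneg)
      fix i
      have "card (occurring_blocks (S i \<inter> E) (?X a)) \<le> card (occurring_blocks (S i \<inter> ?E) (?X a))"
        using fin[of "?X a" "S i"] by (intro card_occurring_blocks_mono) auto
      also have "\<dots> \<le> card (occurring_blocks (S i \<inter> ?E) X)"
        by (intro card_mono fin occurring_blocks_mono) auto
      finally show "card (occurring_blocks (S i \<inter> E) (?X a)) \<le> card (occurring_blocks (S i \<inter> ?E) X)" .
    qed auto
    finally show "?N E (?X a) ^ card J
      \<le> (\<Prod>i\<in>I - J. ?N (S i \<inter> ?E) X) * (\<Prod>i\<in>J. ?N (S i \<inter> E) (?X a))" .
  qed (use \<open>finite \<Lambda>\<close> finJ J \<open>m > 0\<close> in \<open>auto intro: prod_nonneg\<close>)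
  also have "(\<Sum>a\<in>\<Lambda>. ?N E (?X a)) = ?N ?E X"
    using card_occurring_blocks_split[of v ?E \<Lambda> X] insert.prems(1) insert.hyps \<open>finite \<Lambda>\<close> by simp
  also have "(\<Prod>i\<in>J. \<Sum>a\<in>\<Lambda>. ?N (S i \<inter> E) (?X a)) = (\<Prod>i\<in>J. ?N (S i \<inter> ?E) X)"
  proof (intro prod.cong refl)
    fix i assume "i \<in> J"
    then have "v \<in> S i" using J by auto
    then have "S i \<inter> ?E - {v} = S i \<inter> E" using insert.hyps by auto
    then show "(\<Sum>a\<in>\<Lambda>. ?N (S i \<inter> E) (?X a)) = ?N (S i \<inter> ?E) X"
      using insert.prems(1) insert.hyps \<open>v \<in> S i\<close> \<open>finite \<Lambda>\<close>
      by (subst card_occurring_blocks_split[of v "S i \<inter> ?E" \<Lambda> X]) auto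
  qed
  also have "(\<Prod>i\<in>I - J. ?N (S i \<inter> ?E) X) * (\<Prod>i\<in>J. ?N (S i \<inter> ?E) X) = (\<Prod>i\<in>I. ?N (S i \<inter> ?E) X)"
    by (rule prod.subset_diff[OF JI \<open>finite I\<close>, symmetric])
  finally have "real (card (occurring_blocks ?E X) ^ m) \<le> real (\<Prod>i\<in>I. card (occurring_blocks (S i \<inter> ?E) X))"
    using J by simp
  then show ?case by (simp only: of_nat_le_iff)
qed

section \<open>Block counts of symbolic systems over a group\<close>

abbreviation block_count :: "'g set \<Rightarrow> ('g \<Rightarrow> 'l) set \<Rightarrow> nat" where
  "block_count T X \<equiv> card (occurring_blocks T X)"

lemma symbolic_systemD:
  assumes "symbolic_system G \<Lambda> X"
  shows "finite \<Lambda>" "closedin (shift_topology G \<Lambda>) X" "X \<subseteq> full_shift G \<Lambda>"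
    and "g \<in> carrier G \<Longrightarrow> x \<in> X \<Longrightarrow> shift G g x \<in> X"
    and "x \<in> X \<Longrightarrow> v \<in> carrier G \<Longrightarrow> x v \<in> \<Lambda>"
proof -
  show fin: "finite \<Lambda>" and cl: "closedin (shift_topology G \<Lambda>) X"
    and "g \<in> carrier G \<Longrightarrow> x \<in> X \<Longrightarrow> shift G g x \<in> X"
    using assms by (auto simp: symbolic_system_def)
  show sub: "X \<subseteq> full_shift G \<Lambda>"
    using closedin_subset[OF cl] by (simp add: shift_topology_def full_shift_def)
  show "x \<in> X \<Longrightarrow> v \<in> carrier G \<Longrightarrow> x v \<in> \<Lambda>" using sub by (auto simp: full_shift_def)
qed

lemma symbolic_system_finite_blocks:
  assumes "symbolic_system G \<Lambda> X" "finite T" "T \<subseteq> carrier G"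
  shows "finite (occurring_blocks T X)"
  using symbolic_systemD[OF assms(1)] assms(2,3) by (intro finite_occurring_blocks[of _ \<Lambda>]) auto

lemma symbolic_system_block_count_pos:
  assumes "symbolic_system G \<Lambda> X" "finite T" "T \<subseteq> carrier G" "X \<noteq> {}"
  shows "block_count T X > 0"
  using symbolic_system_finite_blocks[OF assms(1-3)] assms(4)
  by (auto simp: card_gt_0_iff occurring_blocks_def)

context group
begin

lemma finite_set_mult: "finite A \<Longrightarrow> finite B \<Longrightarrow> finite (A <#> B)"
  by (simp add: set_mult_def)

lemma set_mult_image: "A <#> B = (\<lambda>(a, b). a \<otimes> b) ` (A \<times> B)"
  by (auto simp: set_mult_def)

lemma card_set_mult_le: "finite A \<Longrightarrow> finite B \<Longrightarrow> card (A <#> B) \<le> card A * card B"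
  unfolding set_mult_image by (metis card_image_le card_cartesian_product finite_SigmaI)

lemma card_r_coset: 
  assumes "A \<subseteq> carrier G" "g \<in> carrier G" shows "card (A #> g) = card A"
proof -
  have "A #> g = (\<lambda>a. a \<otimes> g) ` A" by (auto simp: r_coset_def)
  moreover have "inj_on (\<lambda>a. a \<otimes> g) A" using assms by (intro inj_onI) (auto simp: subset_iff)
  ultimately show ?thesis by (simp add: card_image)
qed

lemma card_l_coset: 
  assumes "A \<subseteq> carrier G" "g \<in> carrier G" shows "card (l_coset G g A) = card A"
proof -
  have "l_coset G g A = (\<lambda>a. g \<otimes> a) ` A" by (auto simp: l_coset_def)
  moreover have "inj_on (\<lambda>a. g \<otimes> a) A" using assms by (intro inj_onI) (auto simp: subset_iff)
  ultimately show ?thesis by (simp add: card_image)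
qed

lemma card_set_mult_ge:
  assumes "A \<subseteq> carrier G" "B \<subseteq> carrier G" "finite A" "finite B"
  shows "A \<noteq> {} \<Longrightarrow> card B \<le> card (A <#> B)" "B \<noteq> {} \<Longrightarrow> card A \<le> card (A <#> B)"
proof -
  have fin: "finite (A <#> B)" using assms by (intro finite_set_mult)
  show "card B \<le> card (A <#> B)" if "A \<noteq> {}"
  proof -
    from that obtain a where a: "a \<in> A" by blast
    then have "l_coset G a B \<subseteq> A <#> B" by (auto simp: l_coset_def set_mult_def)
    from card_mono[OF fin this] show ?thesis using card_l_coset[of B a] a assms by auto
  qed
  show "card A \<le> card (A <#> B)" if "B \<noteq> {}"
  proof -
    from that obtain b where b: "b \<in> B" by blast
    then have "A #> b \<subseteq> A <#> B" by (auto simp: r_coset_def set_mult_def)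
    from card_mono[OF fin this] show ?thesis using card_r_coset[of A b] b assms by auto
  qed
qed

lemma mem_r_coset_iff:
  assumes "A \<subseteq> carrier G" "g \<in> carrier G" "v \<in> carrier G"
  shows "v \<in> A #> g \<longleftrightarrow> v \<otimes> inv g \<in> A"
proof
  assume "v \<in> A #> g" then show "v \<otimes> inv g \<in> A"
    using assms by (auto simp: r_coset_def m_assoc subset_iff)
next
  assume "v \<otimes> inv g \<in> A"
  moreover have "v = (v \<otimes> inv g) \<otimes> g" using assms by (simp add: m_assoc)
  ultimately show "v \<in> A #> g" unfolding r_coset_def by blast
qed

lemma set_inv_closed: "A \<subseteq> carrier G \<Longrightarrow> set_inv A \<subseteq> carrier G"
  by (auto simp: SET_INV_def)

lemma finite_set_inv: "finite A \<Longrightarrow> finite (set_inv A)"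
  by (simp add: SET_INV_def)

lemma card_set_inv: "finite A \<Longrightarrow> card (set_inv A) \<le> card A"
proof -
  assume "finite A"
  have "set_inv A = (\<lambda>a. inv a) ` A" by (auto simp: SET_INV_def)
  then show ?thesis using card_image_le[OF \<open>finite A\<close>] by simp
qed

lemma mem_set_inv_mult_iff:
  assumes "A \<subseteq> carrier G" "E \<subseteq> carrier G" "g \<in> carrier G"
  shows "g \<in> set_inv A <#> E \<longleftrightarrow> (\<exists>a\<in>A. a \<otimes> g \<in> E)"
proof
  assume "g \<in> set_inv A <#> E"
  then obtain a e where "a \<in> A" "e \<in> E" "g = inv a \<otimes> e" by (auto simp: set_mult_def SET_INV_def)
  moreover from this have "a \<otimes> g = e" using assms by (auto simp: subset_iff simp flip: m_assoc)
  ultimately show "\<exists>a\<in>A. a \<otimes> g \<in> E" by metis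
next
  assume "\<exists>a\<in>A. a \<otimes> g \<in> E"
  then obtain a where a: "a \<in> A" "a \<otimes> g \<in> E" by blast
  then have "g = inv a \<otimes> (a \<otimes> g)" using assms by (auto simp: subset_iff simp flip: m_assoc)
  then show "g \<in> set_inv A <#> E" using a by (auto simp: set_mult_def SET_INV_def)
qed

lemma shift_apply: "h \<in> carrier G \<Longrightarrow> shift G g x h = x (h \<otimes> g)"
  by (simp add: shift_def)

lemma shift_shift:
  assumes "g \<in> carrier G" "h \<in> carrier G"
  shows "shift G g (shift G h x) = shift G (g \<otimes> h) x"
  using assms by (auto simp: shift_def m_assoc)

lemma shift_one: "x \<in> full_shift G \<Lambda> \<Longrightarrow> shift G \<one> x = x"
  by (rule extensionalityI[of _ "carrier G"]) (auto simp: shift_def full_shift_def PiE_iff)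

text \<open>
  The action is \<open>(gx)(h) = x(hg)\<close>, so the block of \<open>x\<close> on the right translate \<open>Tg\<close> is the block of
  \<open>gx\<close> on \<open>T\<close>.
\<close>
lemma block_count_translate:
  assumes X: "symbolic_system G \<Lambda> X" and T: "finite T" "T \<subseteq> carrier G" and g: "g \<in> carrier G"
  shows "block_count (T #> g) X \<le> block_count T X"
proof -
  have "occurring_blocks (T #> g) X \<subseteq> (\<lambda>b. \<lambda>v\<in>T #> g. b (v \<otimes> inv g)) ` occurring_blocks T X"
  proof
    fix b assume "b \<in> occurring_blocks (T #> g) X"
    then obtain x where x: "x \<in> X" "b = restrict x (T #> g)" by (auto simp: occurring_blocks_def)
    have "b = (\<lambda>v\<in>T #> g. restrict (shift G g x) T (v \<otimes> inv g))"
      unfolding x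
    proof (rule restrict_ext)
      fix v assume v: "v \<in> T #> g"
      then have vc: "v \<in> carrier G" using T g by (auto simp: r_coset_def)
      then have "v \<otimes> inv g \<in> T" using v mem_r_coset_iff T g by blast
      then show "x v = restrict (shift G g x) T (v \<otimes> inv g)"
        using vc g by (simp add: shift_apply m_assoc)
    qed
    then show "b \<in> (\<lambda>b. \<lambda>v\<in>T #> g. b (v \<otimes> inv g)) ` occurring_blocks T X"
      using symbolic_systemD(4)[OF X g x(1)] unfolding occurring_blocks_def by blast
  qed
  then show ?thesis
    using symbolic_system_finite_blocks[OF X T] by (rule surj_card_le[rotated])
qed

text \<open>
  Shearer's inequality for the family of all right translates of \<open>T\<close> that meet \<open>E\<close>. A point \<open>v\<close> lies
  in \<open>Tg\<close> exactly for the \<open>card T\<close> elements \<open>g = inv t \<otimes> v\<close>, and each translate has at most as many blocks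
  as \<open>T\<close>. The shape of \<open>E\<close> enters only through the size of \<open>set_inv T <#> E\<close>.
\<close>
lemma block_count_shearer:
  assumes X: "symbolic_system G \<Lambda> X" and T: "finite T" "T \<subseteq> carrier G" "T \<noteq> {}"
    and E: "finite E" "E \<subseteq> carrier G"
  shows "block_count E X ^ card T \<le> block_count T X ^ card (set_inv T <#> E)"
proof -
  let ?I = "set_inv T <#> E"
  have I: "finite ?I" "?I \<subseteq> carrier G"
    using T E by (intro finite_set_mult finite_set_inv set_mult_closed set_inv_closed; simp)+
  have "block_count E X ^ card T \<le> (\<Prod>g\<in>?I. block_count ((T #> g) \<inter> E) X)"
  proof (rule shearer[OF E(1) symbolic_systemD(1)[OF X] I(1)])
    show "card T > 0" using T by (simp add: card_gt_0_iff)
    show "x v \<in> \<Lambda>" if "x \<in> X" "v \<in> E" for x v using that symbolic_systemD(5)[OF X] E by blast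
    fix v assume v: "v \<in> E"
    have "(\<lambda>t. inv t \<otimes> v) ` T \<subseteq> {g \<in> ?I. v \<in> T #> g}"
    proof (safe)
      fix t assume t: "t \<in> T"
      then show "inv t \<otimes> v \<in> ?I" using v by (auto simp: set_mult_def SET_INV_def)
      have "v = t \<otimes> (inv t \<otimes> v)" using t v T E by (auto simp: subset_iff simp flip: m_assoc)
      then show "v \<in> T #> (inv t \<otimes> v)" using t unfolding r_coset_def by blast
    qed
    moreover have "inj_on (\<lambda>t. inv t \<otimes> v) T" 
    proof (rule inj_onI)
      fix s t assume "s \<in> T" "t \<in> T" "inv s \<otimes> v = inv t \<otimes> v"
      then show "s = t" using v T E by (metis inv_closed inv_inv right_cancel subsetD)
    qed
    moreover have "finite {g \<in> ?I. v \<in> T #> g}" using I(1) by simp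
    ultimately show "card T \<le> card {g \<in> ?I. v \<in> T #> g}" 
      using card_mono[of "{g \<in> ?I. v \<in> T #> g}" "(\<lambda>t. inv t \<otimes> v) ` T"] by (simp add: card_image)
  qed
  also have "\<dots> \<le> (\<Prod>g\<in>?I. block_count T X)"
  proof (intro prod_mono conjI)
    fix g assume g: "g \<in> ?I"
    then have gc: "g \<in> carrier G" using I by blast
    have "T #> g \<subseteq> carrier G" "finite (T #> g)" using T gc by (auto simp: r_coset_def)
    then have "block_count ((T #> g) \<inter> E) X \<le> block_count (T #> g) X"
      using symbolic_system_finite_blocks[OF X] by (intro card_occurring_blocks_mono) auto
    also have "\<dots> \<le> block_count T X" by (rule block_count_translate[OF X T(1,2) gc])
    finally show "block_count ((T #> g) \<inter> E) X \<le> block_count T X" .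
  qed auto
  finally show ?thesis by simp
qed

lemma log_block_count_le:
  assumes X: "symbolic_system G \<Lambda> X" "X \<noteq> {}" and T: "finite T" "T \<subseteq> carrier G" "T \<noteq> {}"
    and E: "finite E" "E \<subseteq> carrier G"
    and a: "log 2 (block_count T X) \<le> (a::real) * card T"
  shows "log 2 (block_count E X) \<le> a * card (set_inv T <#> E)"
proof -
  have pos: "real (block_count E X) > 0" "real (block_count T X) > 0"
    using symbolic_system_block_count_pos[OF X(1)] T E X(2) by auto
  have cT: "real (card T) > 0" using T by (simp add: card_gt_0_iff)
  have "real (block_count E X) ^ card T \<le> real (block_count T X) ^ card (set_inv T <#> E)"
    using block_count_shearer[OF X(1) T E] by (metis of_nat_le_iff of_nat_power)
  then have "log 2 (real (block_count E X) ^ card T) \<le> log 2 (real (block_count T X) ^ card (set_inv T <#> E))"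
    using pos by (subst log_le_cancel_iff) auto
  then have "card T * log 2 (block_count E X) \<le> card (set_inv T <#> E) * log 2 (block_count T X)"
    using pos by (simp add: log_nat_power)
  also have "\<dots> \<le> card (set_inv T <#> E) * (a * card T)"
    using a by (intro mult_left_mono) auto
  finally have "card T * log 2 (block_count E X) \<le> card T * (a * card (set_inv T <#> E))"
    by (simp add: algebra_simps)
  then show ?thesis using cT by simp
qed

lemma folner_sequenceD:
  assumes "folner_sequence G F"
  shows "F n \<subseteq> carrier G" "finite (F n)" "F n \<noteq> {}" "card (F n) > 0"
  using assms by (auto simp: folner_sequence_def card_gt_0_iff)

section \<open>Folner sequences and the entropy as a limit\<close>

text \<open>
  A finite union of the sets \<open>kF - F\<close>, each negligible compared with \<open>F\<close>, is negligible.
\<close>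
lemma folner_boundary_tendsto_0:
  assumes F: "folner_sequence G F" and K: "finite K" "K \<subseteq> carrier G"
  shows "(\<lambda>n. real (card ((K <#> F n) - F n)) / real (card (F n))) \<longlonglongrightarrow> 0"
proof (rule tendsto_sandwich[where f = "\<lambda>_. 0"
      and h = "\<lambda>n. \<Sum>k\<in>K. real (card (sym_diff (l_coset G k (F n)) (F n))) / real (card (F n))"])
  show "(\<lambda>n. \<Sum>k\<in>K. real (card (sym_diff (l_coset G k (F n)) (F n))) / real (card (F n))) \<longlonglongrightarrow> 0"
    using F K by (intro tendsto_null_sum) (auto simp: folner_sequence_def)
  show "\<forall>\<^sub>F n in sequentially. real (card ((K <#> F n) - F n)) / real (card (F n))
      \<le> (\<Sum>k\<in>K. real (card (sym_diff (l_coset G k (F n)) (F n))) / real (card (F n)))"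
  proof (rule always_eventually, rule allI)
    fix n
    have fin: "finite (sym_diff (l_coset G k (F n)) (F n))" for k
      using folner_sequenceD(2)[OF F] by (auto simp: l_coset_def)
    have "(K <#> F n) - F n \<subseteq> (\<Union>k\<in>K. sym_diff (l_coset G k (F n)) (F n))"
      by (auto simp: set_mult_def l_coset_def)
    then have "card ((K <#> F n) - F n) \<le> card (\<Union>k\<in>K. sym_diff (l_coset G k (F n)) (F n))"
      using fin K by (intro card_mono) auto
    also have "\<dots> \<le> (\<Sum>k\<in>K. card (sym_diff (l_coset G k (F n)) (F n)))"
      by (rule card_UN_le[OF K(1)])
    finally have "real (card ((K <#> F n) - F n)) \<le> (\<Sum>k\<in>K. real (card (sym_diff (l_coset G k (F n)) (F n))))"
      by (simp only: of_nat_le_iff flip: of_nat_sum)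
    then show "real (card ((K <#> F n) - F n)) / real (card (F n))
      \<le> (\<Sum>k\<in>K. real (card (sym_diff (l_coset G k (F n)) (F n))) / real (card (F n)))"
      by (simp add: divide_right_mono flip: sum_divide_distrib)
  qed
qed auto

lemma card_set_mult_le_boundary:
  assumes "finite K" "finite F"
  shows "card (K <#> F) \<le> card F + card ((K <#> F) - F)"
proof -
  have "card (K <#> F) \<le> card (F \<union> ((K <#> F) - F))"
    using assms by (intro card_mono) (auto simp: finite_set_mult)
  also have "\<dots> \<le> card F + card ((K <#> F) - F)" by (rule card_Un_le)
  finally show ?thesis .
qed

lemma folner_eventually_invariant:
  assumes F: "folner_sequence G F" and K: "finite K" "K \<subseteq> carrier G" and \<eta>: "\<eta> > (0::real)"
  shows "\<forall>\<^sub>F n in sequentially. real (card ((K <#> F n) - F n)) \<le> \<eta> * card (F n)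
    \<and> real (card (K <#> F n)) \<le> (1 + \<eta>) * card (F n)"
  using order_tendstoD(2)[OF folner_boundary_tendsto_0[OF F K] \<eta>]
proof eventually_elim
  case (elim n)
  then have "real (card ((K <#> F n) - F n)) \<le> \<eta> * card (F n)"
    using folner_sequenceD(4)[OF F, of n] by (simp add: field_simps)
  then show ?case
    using card_set_mult_le_boundary[OF K(1) folner_sequenceD(2)[OF F], of n] by (simp add: algebra_simps)
qed

text \<open>
  A set \<open>F\<close> with \<open>|KF| \<le> 2|F|\<close> has at least \<open>|K| / 2\<close> elements, because \<open>KF\<close> contains a translate
  of \<open>K\<close>.
\<close>
lemma folner_card_at_top:
  assumes F: "folner_sequence G F" and inf: "infinite (carrier G)"
  shows "filterlim (\<lambda>n. card (F n)) at_top sequentially"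
  unfolding filterlim_at_top
proof
  fix N :: nat
  obtain K where K: "K \<subseteq> carrier G" "finite K" "card K = 2 * N"
    using infinite_arbitrarily_large[OF inf] by metis
  show "\<forall>\<^sub>F n in sequentially. N \<le> card (F n)"
    using folner_eventually_invariant[OF F K(2,1) zero_less_one]
  proof eventually_elim
    case (elim n)
    have "card K \<le> card (K <#> F n)"
      using K folner_sequenceD[OF F, of n] by (intro card_set_mult_ge) auto
    then have "real (2 * N) \<le> 2 * real (card (F n))" using elim K(3) by simp
    then show ?case by simp
  qed
qed

lemma entropy_eqI:
  assumes "amenable G"
    and "\<And>F. folner_sequence G F \<Longrightarrow>
      (\<lambda>n. log 2 (block_count (F n) X) / card (F n)) \<longlonglongrightarrow> h"
  shows "entropy G X = h"
  unfolding entropy_def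
proof (rule the_equality)
  fix h' assume h': "\<forall>F. folner_sequence G F \<longrightarrow>
        (\<lambda>n. log 2 (real (card (occurring_blocks (F n) X))) / real (card (F n))) \<longlonglongrightarrow> h'"
  obtain F where F: "folner_sequence G F" using assms(1) by (auto simp: amenable_def)
  show "h' = h" using h' F assms(2)[OF F] LIMSEQ_unique by blast
qed (use assms(2) in auto)

text \<open>
  The limit exists along every Folner sequence and equals the infimum of \<open>log N(T) / |T|\<close> over all
  finite nonempty \<open>T\<close>. This infimum is an obvious lower bound. Conversely, for each fixed \<open>T\<close>,
  Shearer's inequality gives \<open>log N(F) \<le> (|set_inv T <#> F| / |T|) log N(T)\<close>, and
  \<open>|set_inv T <#> F| / |F|\<close> tends to 1 along a Folner sequence.
\<close>
lemma entropy_tendsto: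
  assumes am: "amenable G" and X: "symbolic_system G \<Lambda> X" "X \<noteq> {}" and F: "folner_sequence G F"
  shows "(\<lambda>n. log 2 (block_count (F n) X) / card (F n)) \<longlonglongrightarrow> entropy G X"
proof -
  define \<T> where "\<T> = {T. finite T \<and> T \<subseteq> carrier G \<and> T \<noteq> {}}"
  define r where "r T = log 2 (block_count T X) / card T" for T
  define h where "h = Inf (r ` \<T>)"
  have r0: "r T \<ge> 0" if "T \<in> \<T>" for T
  proof -
    have "real (block_count T X) \<ge> 1"
      using that symbolic_system_block_count_pos[OF X(1) _ _ X(2), of T] by (simp add: \<T>_def)
    then show ?thesis unfolding r_def by (intro divide_nonneg_nonneg) auto
  qed
  have bdd: "bdd_below (r ` \<T>)" using r0 by (intro bdd_belowI[of _ 0]) auto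
  have "(\<lambda>n. r (F n)) \<longlonglongrightarrow> h" if F: "folner_sequence G F" for F
  proof (rule order_tendstoI)
    have FT: "F n \<in> \<T>" for n using folner_sequenceD[OF F] by (auto simp: \<T>_def)
    fix u assume "u < h"
    then show "\<forall>\<^sub>F n in sequentially. u < r (F n)"
      using cInf_lower[OF imageI[OF FT] bdd] unfolding h_def
      by (intro always_eventually allI) (rule less_le_trans)
  next
    fix u assume "h < u"
    have "{\<one>} \<in> \<T>" by (auto simp: \<T>_def)
    then have "r ` \<T> \<noteq> {}" by blast
    then obtain T where T: "T \<in> \<T>" "r T < u"
      using \<open>h < u\<close> bdd by (auto simp: h_def cInf_less_iff)
    then have T': "finite T" "T \<subseteq> carrier G" "T \<noteq> {}" by (auto simp: \<T>_def)
    then have "card T > 0" by (simp add: card_gt_0_iff)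
    let ?b = "\<lambda>n. real (card ((set_inv T <#> F n) - F n)) / real (card (F n))"
    have "(\<lambda>n. r T * (1 + ?b n)) \<longlonglongrightarrow> r T * (1 + 0)"
      by (intro tendsto_intros folner_boundary_tendsto_0[OF F] finite_set_inv set_inv_closed T')
    then have "\<forall>\<^sub>F n in sequentially. r T * (1 + ?b n) < u"
      using T(2) by (intro order_tendstoD(2)[where a = u]) auto
    then show "\<forall>\<^sub>F n in sequentially. r (F n) < u"
    proof eventually_elim
      case (elim n)
      have cF: "real (card (F n)) > 0" using folner_sequenceD[OF F] by simp
      have "log 2 (block_count (F n) X) \<le> r T * card (set_inv T <#> F n)"
        using \<open>card T > 0\<close> folner_sequenceD[OF F, of n]
        by (intro log_block_count_le[OF X T']) (auto simp: r_def)
      also have "\<dots> \<le> r T * (card (F n) + card ((set_inv T <#> F n) - F n))"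
        using r0[OF T(1)] card_set_mult_le_boundary[OF finite_set_inv[OF T'(1)] folner_sequenceD(2)[OF F], of n]
        by (intro mult_left_mono) linarith+
      finally have "r (F n) \<le> r T * (card (F n) + card ((set_inv T <#> F n) - F n)) / card (F n)"
        using cF unfolding r_def by (intro divide_right_mono) auto
      also have "\<dots> = r T * (1 + ?b n)" using cF by (simp add: field_simps)
      finally show ?case using elim by simp
    qed
  qed
  then have lim: "folner_sequence G F \<Longrightarrow> (\<lambda>n. log 2 (block_count (F n) X) / card (F n)) \<longlonglongrightarrow> h" for F
    by (simp add: r_def)
  from entropy_eqI[OF am this] lim[OF F] show ?thesis by simp
qed

end

section \<open>Compactness and gluing along infinite sets\<close>

text \<open>
  The gluing property with its finite set \<open>D\<close> named, and with blocks replaced by configurations that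
  display them.
\<close>
definition gluing_set :: "('g, 'm) monoid_scheme \<Rightarrow> 'g set \<Rightarrow> ('g \<Rightarrow> 'l) set \<Rightarrow> bool" where
  "gluing_set G D X \<longleftrightarrow> D \<subseteq> carrier G \<and> finite D \<and> \<one>\<^bsub>G\<^esub> \<in> D \<and>
     (\<forall>T1 T2. T1 \<subseteq> carrier G \<and> finite T1 \<and> T2 \<subseteq> carrier G \<and> finite T2 \<and>
        T2 \<inter> (D <#>\<^bsub>G\<^esub> T1) = {} \<longrightarrow>
        (\<forall>x1\<in>X. \<forall>x2\<in>X. \<exists>x\<in>X. (\<forall>v\<in>T1. x v = x1 v) \<and> (\<forall>v\<in>T2. x v = x2 v)))"

lemma gluing_setD:
  assumes "gluing_set G D X"
  shows "D \<subseteq> carrier G" "finite D" "\<one>\<^bsub>G\<^esub> \<in> D"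
    and "T1 \<subseteq> carrier G \<Longrightarrow> finite T1 \<Longrightarrow> T2 \<subseteq> carrier G \<Longrightarrow> finite T2 \<Longrightarrow>
      T2 \<inter> (D <#>\<^bsub>G\<^esub> T1) = {} \<Longrightarrow> x1 \<in> X \<Longrightarrow> x2 \<in> X \<Longrightarrow>
      \<exists>x\<in>X. (\<forall>v\<in>T1. x v = x1 v) \<and> (\<forall>v\<in>T2. x v = x2 v)"
  using assms unfolding gluing_set_def by simp_all

lemma restrict_eq_iff: "restrict x T = restrict y T \<longleftrightarrow> (\<forall>v\<in>T. x v = y v)"
  by (auto simp: fun_eq_iff restrict_def)

lemma gluing_property_iff: "gluing_property G X \<longleftrightarrow> (\<exists>D. gluing_set G D X)"
  unfolding gluing_property_def gluing_set_def occurring_blocks_def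
  by (simp add: restrict_eq_iff ball_simps)

lemma topspace_shift_topology: "topspace (shift_topology G \<Lambda>) = full_shift G \<Lambda>"
  by (simp add: shift_topology_def full_shift_def)

lemma closedin_cylinder:
  assumes "v \<in> carrier G"
  shows "closedin (shift_topology G \<Lambda>) {x \<in> full_shift G \<Lambda>. x v \<in> A}"
proof -
  have "closedin (shift_topology G \<Lambda>) {x \<in> topspace (shift_topology G \<Lambda>). x v \<in> A \<inter> \<Lambda>}"
    using assms unfolding shift_topology_def
    by (intro closedin_continuous_map_preimage[OF continuous_map_product_projection]) auto
  also have "{x \<in> topspace (shift_topology G \<Lambda>). x v \<in> A \<inter> \<Lambda>} = {x \<in> full_shift G \<Lambda>. x v \<in> A}"
    using assms by (auto simp: topspace_shift_topology full_shift_def)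
  finally show ?thesis .
qed

lemma compactin_symbolic_system:
  assumes "symbolic_system G \<Lambda> X"
  shows "compactin (shift_topology G \<Lambda>) X"
proof (rule closedin_compact_space[OF _ symbolic_systemD(2)[OF assms]])
  show "compact_space (shift_topology G \<Lambda>)"
    using symbolic_systemD(1)[OF assms]
    by (simp add: shift_topology_def compact_space_product_topology compact_space_discrete_topology)
qed

text \<open>
  Prescribing the symbol at one position defines a closed set, so by compactness of \<open>X\<close> a partial
  configuration extends to a point of \<open>X\<close> as soon as all its finite parts do.
\<close>
lemma extend_by_compactness:
  assumes X: "symbolic_system G \<Lambda> X" and K: "K \<subseteq> carrier G"
    and fin: "\<And>K'. K' \<subseteq> K \<Longrightarrow> finite K' \<Longrightarrow> \<exists>x\<in>X. \<forall>v\<in>K'. x v = w v"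
  shows "\<exists>x\<in>X. \<forall>v\<in>K. x v = w v"
proof -
  define U where "U v = {x \<in> full_shift G \<Lambda>. x v \<in> {w v}}" for v
  have "X \<inter> \<Inter>(U ` K) \<noteq> {}"
  proof (rule compactin_symbolic_system[OF X, unfolded compactin_fip, THEN conjunct2, rule_format])
    show "(\<forall>C\<in>U ` K. closedin (shift_topology G \<Lambda>) C) \<and>
      (\<forall>\<F>. finite \<F> \<and> \<F> \<subseteq> U ` K \<longrightarrow> X \<inter> \<Inter>\<F> \<noteq> {})"
    proof (intro conjI ballI allI impI)
      fix C assume "C \<in> U ` K"
      then obtain v where "v \<in> carrier G" "C = U v" using K by blast
      then show "closedin (shift_topology G \<Lambda>) C"
        unfolding U_def by (simp only: closedin_cylinder)
    next
      fix \<F> assume "finite \<F> \<and> \<F> \<subseteq> U ` K"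
      then obtain K' where K': "K' \<subseteq> K" "finite K'" "\<F> = U ` K'"
        by (meson finite_subset_image)
      then obtain x where "x \<in> X" "\<forall>v\<in>K'. x v = w v" using fin by blast
      then have "x \<in> X \<inter> \<Inter>\<F>" using K' symbolic_systemD(3)[OF X] by (auto simp: U_def)
      then show "X \<inter> \<Inter>\<F> \<noteq> {}" by blast
    qed
  qed
  then show ?thesis by (auto simp: U_def)
qed

context group
begin

lemma subset_set_mult_one: "\<one> \<in> D \<Longrightarrow> A \<subseteq> carrier G \<Longrightarrow> A \<subseteq> D <#> A"
  by (force simp: set_mult_def)

text \<open>
  Compactness removes the finiteness condition on the two domains of the gluing property.
\<close>
lemma glue_two:
  assumes X: "symbolic_system G \<Lambda> X" and D: "gluing_set G D X"
    and x: "x1 \<in> X" "x2 \<in> X" and T: "T1 \<subseteq> carrier G" "T2 \<subseteq> carrier G" "T2 \<inter> (D <#> T1) = {}"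
  shows "\<exists>x\<in>X. (\<forall>v\<in>T1. x v = x1 v) \<and> (\<forall>v\<in>T2. x v = x2 v)"
proof -
  have T1D: "T1 \<subseteq> D <#> T1" using D T by (intro subset_set_mult_one) (use gluing_setD[OF D] in auto)
  have "\<exists>x\<in>X. \<forall>v\<in>T1 \<union> T2. x v = (if v \<in> T1 then x1 v else x2 v)"
  proof (rule extend_by_compactness[OF X])
    fix K' assume K': "K' \<subseteq> T1 \<union> T2" "finite K'"
    have "T2 \<inter> K' \<inter> (D <#> (T1 \<inter> K')) \<subseteq> T2 \<inter> (D <#> T1)" by (auto simp: set_mult_def)
    then have "T2 \<inter> K' \<inter> (D <#> (T1 \<inter> K')) = {}" using T by blast
    moreover have "T1 \<inter> K' \<subseteq> carrier G" "finite (T1 \<inter> K')" "T2 \<inter> K' \<subseteq> carrier G" "finite (T2 \<inter> K')"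
      using T K' by auto
    ultimately have "\<exists>x\<in>X. (\<forall>v\<in>T1 \<inter> K'. x v = x1 v) \<and> (\<forall>v\<in>T2 \<inter> K'. x v = x2 v)"
      by (intro gluing_setD(4)[OF D] x)
    then obtain x where "x \<in> X" "\<forall>v\<in>T1 \<inter> K'. x v = x1 v" "\<forall>v\<in>T2 \<inter> K'. x v = x2 v"
      by blast
    then show "\<exists>x\<in>X. \<forall>v\<in>K'. x v = (if v \<in> T1 then x1 v else x2 v)"
      using K' by (intro bexI[of _ x]) auto
  qed (use T in auto)
  then obtain x where "x \<in> X" and x: "\<forall>v\<in>T1 \<union> T2. x v = (if v \<in> T1 then x1 v else x2 v)" by blast
  moreover have "v \<notin> T1" if "v \<in> T2" for v using that T T1D by blast
  ultimately show ?thesis by (intro bexI[of _ x]) auto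
qed

text \<open>
  Finitely many pieces are glued one after the other, infinitely many by compactness.
\<close>
lemma glue_family:
  assumes X: "symbolic_system G \<Lambda> X" "X \<noteq> {}" and D: "gluing_set G D X"
    and x: "\<And>c. c \<in> C \<Longrightarrow> x c \<in> X" and K: "\<And>c. c \<in> C \<Longrightarrow> K c \<subseteq> carrier G"
    and sep: "\<And>c c'. c \<in> C \<Longrightarrow> c' \<in> C \<Longrightarrow> c \<noteq> c' \<Longrightarrow> K c \<inter> (D <#> K c') = {}"
  shows "\<exists>y\<in>X. \<forall>c\<in>C. \<forall>v\<in>K c. y v = x c v"
proof -
  have fin: "\<exists>y\<in>X. \<forall>c\<in>C'. \<forall>v\<in>K c. y v = x c v" if "finite C'" "C' \<subseteq> C" for C'
    using that
  proof (induction C' rule: finite_induct)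
    case empty then show ?case using X(2) by blast
  next
    case (insert c C')
    then obtain y where y: "y \<in> X" "\<forall>c\<in>C'. \<forall>v\<in>K c. y v = x c v" by auto
    have "K c \<inter> (D <#> (\<Union>c'\<in>C'. K c')) = {}"
    proof (rule equals0I)
      fix v assume "v \<in> K c \<inter> (D <#> (\<Union>c'\<in>C'. K c'))"
      then obtain c' where "c' \<in> C'" "v \<in> K c \<inter> (D <#> K c')" by (auto simp: set_mult_def)
      moreover from this have "c \<noteq> c'" using insert.hyps by blast
      ultimately show False using sep[of c c'] insert.prems by auto
    qed
    moreover have "(\<Union>c'\<in>C'. K c') \<subseteq> carrier G" "K c \<subseteq> carrier G" "x c \<in> X"
      using K x insert.prems by auto
    ultimately have "\<exists>y'\<in>X. (\<forall>v\<in>\<Union>c'\<in>C'. K c'. y' v = y v) \<and> (\<forall>v\<in>K c. y' v = x c v)"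
      by (intro glue_two[OF X(1) D y(1)])
    then obtain y' where "y' \<in> X" "\<forall>v\<in>\<Union>c'\<in>C'. K c'. y' v = y v" "\<forall>v\<in>K c. y' v = x c v"
      by blast
    then show ?case using y by (intro bexI[of _ y']) auto
  qed
  have disj: "c = c'" if "c \<in> C" "c' \<in> C" "v \<in> K c" "v \<in> K c'" for c c' v
  proof (rule ccontr)
    assume "c \<noteq> c'"
    moreover have "K c' \<subseteq> D <#> K c'" using D K that by (intro subset_set_mult_one) (use gluing_setD[OF D] in auto)
    ultimately show False using sep[of c c'] that by blast
  qed
  define w where "w v = x (THE c. c \<in> C \<and> v \<in> K c) v" for v
  have w: "w v = x c v" if "c \<in> C" "v \<in> K c" for c v
  proof -
    have "(THE c. c \<in> C \<and> v \<in> K c) = c" using that disj by (intro the_equality) auto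
    then show ?thesis by (simp add: w_def)
  qed
  have "\<exists>y\<in>X. \<forall>v\<in>\<Union>c\<in>C. K c. y v = w v"
  proof (rule extend_by_compactness[OF X(1)])
    fix K' assume K': "K' \<subseteq> (\<Union>c\<in>C. K c)" "finite K'"
    then have "\<forall>v\<in>K'. \<exists>c. c \<in> C \<and> v \<in> K c" by auto
    then obtain f where f: "\<forall>v\<in>K'. f v \<in> C \<and> v \<in> K (f v)" by metis
    have "finite (f ` K')" "f ` K' \<subseteq> C" using f K' by auto
    then obtain y where "y \<in> X" "\<forall>c\<in>f ` K'. \<forall>v\<in>K c. y v = x c v"
      using fin by blast
    then show "\<exists>y\<in>X. \<forall>v\<in>K'. y v = w v" using f w by (intro bexI[of _ y]) auto
  qed (use K in auto)
  then obtain y where "y \<in> X" and y: "\<forall>v\<in>\<Union>c\<in>C. K c. y v = w v" by blast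
  moreover have "y v = x c v" if "c \<in> C" "v \<in> K c" for c v using y w[OF that] that by auto
  ultimately show ?thesis by blast
qed

text \<open>
  The points of \<open>X\<close> all of whose windows of shape \<open>F\<close> show a block that occurs somewhere in \<open>x\<close>. This
  is a subsystem containing \<open>x\<close> whose blocks on \<open>F\<close> are under control, and it is easier to handle than
  the orbit closure of \<open>x\<close>.
\<close>
lemma subsystem_with_window_blocks:
  assumes X: "symbolic_system G \<Lambda> X" and x: "x \<in> X" and F: "finite F" "F \<subseteq> carrier G"
  obtains Z where "symbolic_system G \<Lambda> Z" "Z \<subseteq> X" "Z \<noteq> {}"
    "block_count F Z \<le> block_count F {shift G g x | g. g \<in> carrier G}"
proof -
  define \<B> where "\<B> = occurring_blocks F {shift G g x | g. g \<in> carrier G}"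
  define Z where "Z = {y \<in> X. \<forall>g\<in>carrier G. restrict (shift G g y) F \<in> \<B>}"
  note XD = symbolic_systemD[OF X]
  have "{shift G g x | g. g \<in> carrier G} \<subseteq> X" using XD(4) x by auto
  then have "\<B> \<subseteq> occurring_blocks F X" unfolding \<B>_def by (rule occurring_blocks_mono)
  then have finB: "finite \<B>"
    using symbolic_system_finite_blocks[OF X F] by (rule finite_subset)
  have Zeq: "Z = X \<inter> (\<Inter>g\<in>carrier G. \<Union>b\<in>\<B>. full_shift G \<Lambda> \<inter> (\<Inter>v\<in>F. {y \<in> full_shift G \<Lambda>. y (v \<otimes> g) \<in> {b v}}))"
    (is "_ = ?R")
  proof (rule Set.set_eqI)
    fix y
    have *: "restrict (shift G g y) F \<in> \<B> \<longleftrightarrow> (\<exists>b\<in>\<B>. \<forall>v\<in>F. y (v \<otimes> g) = b v)" if "g \<in> carrier G" for g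
    proof
      assume "restrict (shift G g y) F \<in> \<B>"
      then show "\<exists>b\<in>\<B>. \<forall>v\<in>F. y (v \<otimes> g) = b v"
        using F by (intro bexI[of _ "restrict (shift G g y) F"]) (auto simp: shift_apply subset_iff)
    next
      assume "\<exists>b\<in>\<B>. \<forall>v\<in>F. y (v \<otimes> g) = b v"
      then obtain b where b: "b \<in> \<B>" "\<forall>v\<in>F. y (v \<otimes> g) = b v" by blast
      have "b \<in> extensional F" using b(1) by (auto simp: \<B>_def occurring_blocks_def)
      then have "restrict (shift G g y) F = b"
        using b(2) F by (intro extensionalityI[of _ F]) (auto simp: shift_apply subset_iff)
      then show "restrict (shift G g y) F \<in> \<B>" using b by simp
    qed
    show "y \<in> Z \<longleftrightarrow> y \<in> ?R"
      using XD(3) by (auto simp: Z_def *)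
  qed
  have cl: "closedin (shift_topology G \<Lambda>) Z"
    unfolding Zeq
  proof (intro closedin_Int XD(2) closedin_INT)
    show "closedin (shift_topology G \<Lambda>) (\<Union>b\<in>\<B>. full_shift G \<Lambda> \<inter> (\<Inter>v\<in>F. {y \<in> full_shift G \<Lambda>. y (v \<otimes> g) \<in> {b v}}))"
      if g: "g \<in> carrier G" for g
    proof (rule closedin_Union)
      fix S assume "S \<in> (\<lambda>b. full_shift G \<Lambda> \<inter> (\<Inter>v\<in>F. {y \<in> full_shift G \<Lambda>. y (v \<otimes> g) \<in> {b v}})) ` \<B>"
      then obtain b where S: "S = full_shift G \<Lambda> \<inter> (\<Inter>v\<in>F. {y \<in> full_shift G \<Lambda>. y (v \<otimes> g) \<in> {b v}})" by blast
      show "closedin (shift_topology G \<Lambda>) S"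
      proof (cases "F = {}")
        case True
        then show ?thesis using closedin_topspace[of "shift_topology G \<Lambda>"] by (simp add: S topspace_shift_topology)
      next
        case False
        then show ?thesis unfolding S
          using closedin_topspace[of "shift_topology G \<Lambda>"] g F
          by (intro closedin_Int closedin_INT closedin_cylinder) (auto simp: topspace_shift_topology)
      qed
    qed (use finB in auto)
  qed auto
  have "symbolic_system G \<Lambda> Z"
    unfolding symbolic_system_def
  proof (intro conjI XD(1) cl ballI)
    fix g y assume g: "g \<in> carrier G" and y: "y \<in> Z"
    have "restrict (shift G h (shift G g y)) F \<in> \<B>" if "h \<in> carrier G" for h
      using y g that by (simp add: shift_shift Z_def)
    then show "shift G g y \<in> Z" using y g XD(4) by (simp add: Z_def)
  qed
  moreover have "x \<in> Z"
    using x by (auto simp: Z_def \<B>_def occurring_blocks_def)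
  moreover have "block_count F Z \<le> card \<B>"
  proof (rule card_mono[OF finB])
    show "occurring_blocks F Z \<subseteq> \<B>"
    proof
      fix b assume "b \<in> occurring_blocks F Z"
      then obtain y where y: "y \<in> Z" "b = restrict y F" by (auto simp: occurring_blocks_def)
      then have "restrict (shift G \<one> y) F \<in> \<B>" by (simp add: Z_def)
      moreover have "shift G \<one> y = y" using shift_one XD(3) y by (auto simp: Z_def)
      ultimately show "b \<in> \<B>" using y by simp
    qed
  qed
  ultimately show ?thesis using that by (auto simp: \<B>_def Z_def)
qed

end

section \<open>Coverings by tiles of bounded overlap\<close>

text \<open>
  Greedy colouring along an enumeration: each vertex has at most \<open>d\<close> neighbours, so one of the colours
  \<open>0, ..., d\<close> is not taken by an earlier neighbour.
\<close>
lemma bounded_degree_colouring: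
  assumes V: "countable V"
    and deg: "\<And>v. v \<in> V \<Longrightarrow> finite {u\<in>V. adj u v} \<and> card {u\<in>V. adj u v} \<le> d"
    and sym: "\<And>u v. adj u v \<Longrightarrow> adj v u"
  shows "\<exists>col. (\<forall>v\<in>V. col v \<le> d) \<and> (\<forall>u\<in>V. \<forall>v\<in>V. u \<noteq> v \<longrightarrow> adj u v \<longrightarrow> col u \<noteq> (col v :: nat))"
proof -
  let ?i = "to_nat_on V"
  define P where "P f v r \<longleftrightarrow> (v \<in> V \<longrightarrow> r \<le> d \<and> (\<forall>u\<in>V. ?i u < ?i v \<longrightarrow> adj u v \<longrightarrow> f u \<noteq> r))"
    for f :: "'a \<Rightarrow> nat" and v r
  have "\<exists>col. \<forall>v. P col v (col v)"
  proof (rule dependent_wf_choice[where R = "Wellfounded.measure ?i"])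
    show "P f v r = P g v r" if "\<And>u. (u, v) \<in> Wellfounded.measure ?i \<Longrightarrow> f u = g u" for f g v r
      using that by (auto simp: P_def)
    show "\<exists>r. P f v r" if "\<And>u. (u, v) \<in> Wellfounded.measure ?i \<Longrightarrow> P f u (f u)" for f v
    proof (cases "v \<in> V")
      case True
      let ?B = "f ` {u\<in>V. adj u v}"
      have "finite ?B" "card ?B \<le> d" using deg[OF True] card_image_le[of "{u\<in>V. adj u v}" f] by auto
      then have "\<not> {..d} \<subseteq> ?B" using card_mono[of ?B "{..d}"] by auto
      then obtain r where "r \<le> d" "r \<notin> ?B" by auto
      then have "P f v r" by (auto simp: P_def)
      then show ?thesis ..
    qed (auto simp: P_def)
  qed auto
  then obtain col where col: "\<And>v. P col v (col v)" by blast
  have "col u \<noteq> col v" if uv: "u \<in> V" "v \<in> V" "u \<noteq> v" "adj u v" for u v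
  proof (cases "?i u < ?i v")
    case True then show ?thesis using col[of v] uv by (auto simp: P_def)
  next
    case False
    have "?i u \<noteq> ?i v" using uv V by simp
    then have "?i v < ?i u" using False by simp
    then show ?thesis using col[of u] uv sym[of u v] by (auto simp: P_def)
  qed
  then show ?thesis using col by (intro exI[of _ col]) (auto simp: P_def)
qed

context group
begin

text \<open>
  Take a maximal family of translates \<open>Sc\<close> equipped with pairwise disjoint subsets of at least half
  their size. Disjointness bounds the density of the centres \<open>c\<close>, and by maximality every translate
  of \<open>S\<close> is at least half covered: otherwise its uncovered part could be added to the family.
\<close>
lemma half_disjoint_tiles:
  assumes S: "finite S" "S \<subseteq> carrier G" "S \<noteq> {}"
  obtains C where "C \<subseteq> carrier G"
    "\<And>g. g \<in> carrier G \<Longrightarrow> card S \<le> 2 * card ((S #> g) \<inter> (S <#> C))"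
    "\<And>F. finite F \<Longrightarrow> F \<subseteq> carrier G \<Longrightarrow> card (C \<inter> F) * card S \<le> 2 * card (S <#> F)"
proof -
  \<comment> \<open>A family is a relation between centres and the points reserved for them, so that unions of
    chains are again families.\<close>
  define ok where "ok M \<longleftrightarrow> (\<forall>(c, v)\<in>M. c \<in> carrier G \<and> v \<in> S #> c) \<and>
    (\<forall>c c' v. (c, v) \<in> M \<longrightarrow> (c', v) \<in> M \<longrightarrow> c = c') \<and>
    (\<forall>c\<in>Domain M. card S \<le> 2 * card (M `` {c}))" for M
  have finS: "finite (S #> g)" for g using S by (simp add: r_coset_def)
  have "\<exists>M\<in>Collect ok. \<forall>M'\<in>Collect ok. M \<subseteq> M' \<longrightarrow> M' = M"
  proof (rule subset_Zorn')
    fix \<C> assume "subset.chain (Collect ok) \<C>"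
    then have ch: "\<And>M. M \<in> \<C> \<Longrightarrow> ok M" "\<And>M M'. M \<in> \<C> \<Longrightarrow> M' \<in> \<C> \<Longrightarrow> M \<subseteq> M' \<or> M' \<subseteq> M"
      by (auto simp: subset_chain_def)
    have "ok (\<Union>\<C>)"
      unfolding ok_def
    proof (intro conjI)
      show 1: "\<forall>(c, v)\<in>\<Union>\<C>. c \<in> carrier G \<and> v \<in> S #> c" using ch(1) unfolding ok_def by blast
      show "\<forall>c c' v. (c, v) \<in> \<Union>\<C> \<longrightarrow> (c', v) \<in> \<Union>\<C> \<longrightarrow> c = c'"
      proof (intro allI impI)
        fix c c' v assume "(c, v) \<in> \<Union>\<C>" "(c', v) \<in> \<Union>\<C>"
        then obtain M where "M \<in> \<C>" "(c, v) \<in> M" "(c', v) \<in> M" using ch(2) by blast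
        then show "c = c'" using ch(1) unfolding ok_def by blast
      qed
      show "\<forall>c\<in>Domain (\<Union>\<C>). card S \<le> 2 * card (\<Union>\<C> `` {c})"
      proof
        fix c assume "c \<in> Domain (\<Union>\<C>)"
        then obtain M where M: "M \<in> \<C>" "c \<in> Domain M" by auto
        have "\<Union>\<C> `` {c} \<subseteq> S #> c" using 1 by blast
        then have "card (M `` {c}) \<le> card (\<Union>\<C> `` {c})"
          using M finS by (intro card_mono finite_subset[OF _ finS[of c]]) auto
        moreover have "card S \<le> 2 * card (M `` {c})" using ch(1)[OF M(1)] M(2) unfolding ok_def by blast
        ultimately show "card S \<le> 2 * card (\<Union>\<C> `` {c})" by linarith
      qed
    qed
    then show "\<Union>\<C> \<in> Collect ok" by simp
  qed
  then obtain M where M: "ok M" and max: "\<And>M'. ok M' \<Longrightarrow> M \<subseteq> M' \<Longrightarrow> M' = M" by auto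
  define C where "C = Domain M"
  have C: "C \<subseteq> carrier G" using M unfolding C_def ok_def by auto
  have tile: "M `` {c} \<subseteq> S #> c" for c using M unfolding ok_def by auto
  have RM: "Range M \<subseteq> S <#> C"
  proof
    fix v assume "v \<in> Range M"
    then obtain c where "(c, v) \<in> M" by blast
    then have "c \<in> C" "v \<in> S #> c" using tile[of c] by (auto simp: C_def)
    then show "v \<in> S <#> C" by (auto simp: set_mult_def r_coset_def)
  qed
  show ?thesis
  proof (rule that[OF C])
    fix g assume g: "g \<in> carrier G"
    show "card S \<le> 2 * card ((S #> g) \<inter> (S <#> C))"
    proof (rule ccontr)
      assume less: "\<not> card S \<le> 2 * card ((S #> g) \<inter> (S <#> C))"
      have cg: "card (S #> g) = card S" using card_r_coset S g by blast
      have gC: "g \<notin> C"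
      proof
        assume "g \<in> C"
        then have "S #> g \<subseteq> S <#> C" by (auto simp: set_mult_def r_coset_def)
        then show False using less cg by (simp add: Int_absorb2)
      qed
      define N where "N = (S #> g) - Range M"
      have "card (S #> g) = card ((S #> g) \<inter> (S <#> C)) + card ((S #> g) - (S <#> C))"
        using finS[of g] by (metis Diff_Diff_Int Diff_subset add.commute card_Diff_subset card_mono
            finite_Diff le_add_diff_inverse)
      moreover have "card ((S #> g) - (S <#> C)) \<le> card N"
        using RM finS by (intro card_mono) (auto simp: N_def)
      ultimately have N: "card S < 2 * card N" using less cg by linarith
      define M' where "M' = M \<union> {g} \<times> N"
      have im: "M' `` {c} = (if c = g then N else M `` {c})" for c
        using gC by (auto simp: M'_def C_def)
      have "ok M'"
        unfolding ok_def
      proof (intro conjI)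
        show "\<forall>(c, v)\<in>M'. c \<in> carrier G \<and> v \<in> S #> c"
          using M g unfolding ok_def M'_def N_def by auto
        show "\<forall>c c' v. (c, v) \<in> M' \<longrightarrow> (c', v) \<in> M' \<longrightarrow> c = c'"
          using M unfolding ok_def M'_def N_def by auto
        show "\<forall>c\<in>Domain M'. card S \<le> 2 * card (M' `` {c})"
        proof
          fix c assume "c \<in> Domain M'"
          then have "c = g \<or> c \<in> Domain M" by (auto simp: M'_def)
          then show "card S \<le> 2 * card (M' `` {c})"
            using N M unfolding im ok_def by auto
        qed
      qed
      then have "M' = M" by (rule max) (auto simp: M'_def)
      moreover have "N \<noteq> {}" using N by auto
      ultimately have "g \<in> C" by (auto simp: M'_def C_def)
      then show False using gC by simp
    qed
  next
    fix F assume F: "finite F" "F \<subseteq> carrier G"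
    have "card (C \<inter> F) * card S = (\<Sum>c\<in>C \<inter> F. card S)" by simp
    also have "\<dots> \<le> (\<Sum>c\<in>C \<inter> F. 2 * card (M `` {c}))"
      using M by (intro sum_mono) (auto simp: ok_def C_def)
    also have "\<dots> = 2 * card (\<Union>c\<in>C \<inter> F. M `` {c})"
    proof (subst card_UN_disjoint)
      show "\<forall>i\<in>C \<inter> F. \<forall>j\<in>C \<inter> F. i \<noteq> j \<longrightarrow> M `` {i} \<inter> M `` {j} = {}"
        using M unfolding ok_def by blast
    qed (use F finite_subset[OF tile finS] in \<open>auto simp: sum_distrib_left\<close>)
    also have "card (\<Union>c\<in>C \<inter> F. M `` {c}) \<le> card (S <#> F)"
    proof (rule card_mono)
      show "finite (S <#> F)" using S F by (intro finite_set_mult)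
      show "(\<Union>c\<in>C \<inter> F. M `` {c}) \<subseteq> S <#> F"
        using tile by (force simp: set_mult_def r_coset_def)
    qed
    finally show "card (C \<inter> F) * card S \<le> 2 * card (S <#> F)" by simp
  qed
qed

text \<open>
  If every translate of \<open>S\<close> is half covered by \<open>SC\<close>, then by double counting \<open>SC\<close> covers at least
  half of \<open>F\<close>, up to the boundary \<open>SF - F\<close>.
\<close>
lemma half_cover:
  assumes S: "finite S" "S \<subseteq> carrier G" "S \<noteq> {}"
  obtains C where "C \<subseteq> carrier G"
    "\<And>F. finite F \<Longrightarrow> F \<subseteq> carrier G \<Longrightarrow> 2 * card (F - (S <#> C)) \<le> card F + 2 * card ((S <#> F) - F)"
    "\<And>F. finite F \<Longrightarrow> F \<subseteq> carrier G \<Longrightarrow> card (C \<inter> F) * card S \<le> 2 * card (S <#> F)"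
proof -
  obtain C where C: "C \<subseteq> carrier G"
    and cov: "\<And>g. g \<in> carrier G \<Longrightarrow> card S \<le> 2 * card ((S #> g) \<inter> (S <#> C))"
    and dens: "\<And>F. finite F \<Longrightarrow> F \<subseteq> carrier G \<Longrightarrow> card (C \<inter> F) * card S \<le> 2 * card (S <#> F)"
    using half_disjoint_tiles[OF S] by blast
  show ?thesis
  proof (rule that[OF C _ dens])
    fix F assume F: "finite F" "F \<subseteq> carrier G"
    let ?V = "(S <#> F) \<inter> (S <#> C)"
    have SFc: "S <#> F \<subseteq> carrier G" using S F by (intro set_mult_closed)
    have finV: "finite ?V" using S F by (simp add: finite_set_mult)
    \<comment> \<open>Count the pairs \<open>(g, v)\<close> with \<open>g \<in> F\<close> and \<open>v \<in> Sg \<inter> SC\<close> in two ways.\<close>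
    have "card F * card S = (\<Sum>g\<in>F. card S)" by simp
    also have "\<dots> \<le> (\<Sum>g\<in>F. 2 * card ((S #> g) \<inter> (S <#> C)))"
      using cov F by (intro sum_mono) auto
    also have "\<dots> = 2 * (\<Sum>g\<in>F. card {v\<in>?V. v \<in> S #> g})"
    proof -
      have "(S #> g) \<inter> (S <#> C) = {v\<in>?V. v \<in> S #> g}" if "g \<in> F" for g
        using that by (auto simp: set_mult_def r_coset_def)
      then show ?thesis by (simp add: sum_distrib_left)
    qed
    also have "(\<Sum>g\<in>F. card {v\<in>?V. v \<in> S #> g}) = (\<Sum>v\<in>?V. card {g\<in>F. v \<in> S #> g})"
      using F(1) finV by (rule sum_multicount_gen) simp
    also have "\<dots> \<le> (\<Sum>v\<in>?V. card S)"
    proof (rule sum_mono)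
      fix v assume "v \<in> ?V"
      then have v: "v \<in> carrier G" using SFc by blast
      show "card {g\<in>F. v \<in> S #> g} \<le> card S"
      proof (rule card_inj_on_le[of "\<lambda>g. v \<otimes> inv g"])
        show "inj_on (\<lambda>g. v \<otimes> inv g) {g\<in>F. v \<in> S #> g}"
        proof (rule inj_onI)
          fix g h assume "g \<in> {g\<in>F. v \<in> S #> g}" "h \<in> {g\<in>F. v \<in> S #> g}" "v \<otimes> inv g = v \<otimes> inv h"
          then show "g = h" using v F by (metis (no_types, lifting) inv_closed inv_inv Units_eq Units_l_cancel mem_Collect_eq subsetD)
        qed
        show "(\<lambda>g. v \<otimes> inv g) ` {g\<in>F. v \<in> S #> g} \<subseteq> S"
          using mem_r_coset_iff[OF S(2)] v F by auto
      qed (rule S(1))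
    qed
    finally have "card F * card S \<le> (2 * card ?V) * card S" by simp
    then have "card F \<le> 2 * card ?V" using S by (simp add: card_gt_0_iff)
    moreover have "card ?V \<le> card ((F \<inter> (S <#> C)) \<union> ((S <#> F) - F))"
      using S F by (intro card_mono) (auto simp: finite_set_mult)
    moreover have "card ((F \<inter> (S <#> C)) \<union> ((S <#> F) - F)) \<le> card (F \<inter> (S <#> C)) + card ((S <#> F) - F)"
      by (rule card_Un_le)
    moreover have "card F = card (F \<inter> (S <#> C)) + card (F - (S <#> C))"
      using card_Int_Diff[OF F(1)] by simp
    ultimately show "2 * card (F - (S <#> C)) \<le> card F + 2 * card ((S <#> F) - F)" by linarith
  qed
qed

end

section \<open>Overwriting tiles by a fixed pattern\<close>

context group
begin

text \<open>
  Starting from \<open>z\<close>, the tiles \<open>Tc\<close> are overwritten with copies of the pattern of \<open>a\<close> on \<open>T\<close>, one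
  class \<open>Cs i\<close> of mutually separated tiles after the other. Writing a tile may disturb the
  configuration on the larger set \<open>DTc\<close>, so a position of a tile keeps its prescribed symbol if
  no later tile comes close, and a position outside all sets \<open>DTc\<close> keeps the symbol of \<open>z\<close>.
\<close>
lemma overwrite_tiles:
  fixes n :: nat
  assumes X: "symbolic_system G \<Lambda> X" and D: "gluing_set G D X" and z: "z \<in> X" and a: "a \<in> X"
    and T: "T \<subseteq> carrier G" and Cs: "\<And>i. Cs i \<subseteq> carrier G"
    and sep: "\<And>i c c'. c \<in> Cs i \<Longrightarrow> c' \<in> Cs i \<Longrightarrow> c \<noteq> c' \<Longrightarrow> (T #> c) \<inter> (D <#> (T #> c')) = {}"
  shows "\<exists>x\<in>X. (\<forall>v\<in>carrier G. (\<forall>i<n. v \<notin> (D <#> T) <#> Cs i) \<longrightarrow> x v = z v) \<and>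
    (\<forall>i<n. \<forall>c\<in>Cs i. \<forall>v\<in>T #> c. (\<forall>j. i < j \<longrightarrow> j < n \<longrightarrow> v \<notin> (D <#> T) <#> Cs j) \<longrightarrow> x v = a (v \<otimes> inv c))"
proof (induction n)
  case 0
  then show ?case using z by auto
next
  case (Suc n)
  then obtain x where x: "x \<in> X"
    and xz: "\<And>v. v \<in> carrier G \<Longrightarrow> (\<And>i. i < n \<Longrightarrow> v \<notin> (D <#> T) <#> Cs i) \<Longrightarrow> x v = z v"
    and xa: "\<And>i c v. i < n \<Longrightarrow> c \<in> Cs i \<Longrightarrow> v \<in> T #> c \<Longrightarrow>
      (\<And>j. i < j \<Longrightarrow> j < n \<Longrightarrow> v \<notin> (D <#> T) <#> Cs j) \<Longrightarrow> x v = a (v \<otimes> inv c)"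
    by blast
  have Dc: "D \<subseteq> carrier G" using gluing_setD[OF D] by simp
  have cc: "c \<in> carrier G" if "c \<in> Cs i" for c i using Cs that by blast
  have Tc: "T #> c \<subseteq> carrier G" if "c \<in> Cs i" for c i
    using T cc[OF that] by (rule r_coset_subset_G)
  have "\<exists>y\<in>X. \<forall>c\<in>Cs n. \<forall>v\<in>T #> c. y v = shift G (inv c) a v"
  proof (rule glue_family[OF X _ D])
    show "shift G (inv c) a \<in> X" if "c \<in> Cs n" for c
      using cc[OF that] a by (intro symbolic_systemD(4)[OF X]) auto
  qed (use z Tc sep in auto)
  then obtain y where y: "y \<in> X" "\<And>c v. c \<in> Cs n \<Longrightarrow> v \<in> T #> c \<Longrightarrow> y v = shift G (inv c) a v"
    by blast
  have TC: "T <#> Cs n \<subseteq> carrier G" using T Cs by (rule set_mult_closed)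
  have assoc: "D <#> (T <#> Cs n) = (D <#> T) <#> Cs n" using set_mult_assoc[OF Dc T Cs] by simp
  have "\<exists>x'\<in>X. (\<forall>v\<in>T <#> Cs n. x' v = y v) \<and> (\<forall>v\<in>carrier G - (D <#> (T <#> Cs n)). x' v = x v)"
    using TC by (intro glue_two[OF X D y(1) x]) auto
  then obtain x' where x': "x' \<in> X" "\<And>v. v \<in> T <#> Cs n \<Longrightarrow> x' v = y v"
    "\<And>v. v \<in> carrier G \<Longrightarrow> v \<notin> (D <#> T) <#> Cs n \<Longrightarrow> x' v = x v"
    unfolding assoc by blast
  show ?case
  proof (intro bexI[OF _ x'(1)] conjI ballI allI impI)
    fix v assume "v \<in> carrier G" "\<forall>i<Suc n. v \<notin> (D <#> T) <#> Cs i"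
    then show "x' v = z v" using x'(3)[of v] xz[of v] by simp
  next
    fix i c v assume i: "i < Suc n" and c: "c \<in> Cs i" and v: "v \<in> T #> c"
      and later: "\<forall>j. i < j \<longrightarrow> j < Suc n \<longrightarrow> v \<notin> (D <#> T) <#> Cs j"
    have vc: "v \<in> carrier G" using Tc[OF c] v by blast
    show "x' v = a (v \<otimes> inv c)"
    proof (cases "i = n")
      case True
      then have "v \<in> T <#> Cs n" using c v by (auto simp: set_mult_def r_coset_def)
      then show ?thesis using x'(2) y(2) c v True vc by (simp add: shift_apply)
    next
      case False
      then show ?thesis using x'(3)[of v] xa[of i c v] i c v later vc by simp
    qed
  qed
qed

lemma translate_mem_iff:
  assumes "A \<subseteq> carrier G" "c \<in> carrier G" "g \<in> carrier G" "v \<in> carrier G"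
  shows "v \<otimes> g \<in> A #> c \<longleftrightarrow> v \<in> A #> (c \<otimes> inv g)"
  using assms by (simp add: mem_r_coset_iff inv_mult_group m_assoc)

text \<open>
  Counting the windows of the overwritten configuration \<open>x\<close>. The labelling \<open>lab g\<close> records, relative
  to the window \<open>Fg\<close>, the centres of all tiles near the window together with their colours; the value
  \<open>0\<close> means that there is no centre. Given the labelling, the positions of the window fall into three
  kinds: those in the boundary \<open>Wc - Tc\<close> of some tile, where any symbol may appear; those outside
  \<open>WC\<close>, where \<open>x\<close> agrees with a point of \<open>Z\<close>; and the remaining ones, where the symbol is prescribed
  by the last tile nearby and hence is known.
\<close>
lemma orbit_block_count_le:
  assumes X: "symbolic_system G \<Lambda> X" and x: "x \<in> X" and Z: "symbolic_system G \<Lambda> Z" "z \<in> Z"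
    and C: "C \<subseteq> carrier G" and col: "\<And>c. c \<in> C \<Longrightarrow> col c < n"
    and W: "finite W" "W \<subseteq> carrier G" and TW: "T \<subseteq> W" and F: "finite F" "F \<subseteq> carrier G"
    and out: "\<And>v. v \<in> carrier G \<Longrightarrow> v \<notin> W <#> C \<Longrightarrow> x v = z v"
    and tile: "\<And>c v. c \<in> C \<Longrightarrow> v \<in> T #> c \<Longrightarrow>
        (\<And>c'. c' \<in> C \<Longrightarrow> col c < col c' \<Longrightarrow> v \<notin> W #> c') \<Longrightarrow> x v = a (v \<otimes> inv c)"
    and K: "\<And>g. g \<in> carrier G \<Longrightarrow> real (card \<Lambda>) ^ card {v\<in>F. \<exists>c\<in>C. v \<otimes> g \<in> (W #> c) - (T #> c)} *
        real (block_count {v\<in>F. v \<otimes> g \<notin> W <#> C} Z) \<le> K"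
  defines "lab \<equiv> \<lambda>g. \<lambda>u\<in>set_inv W <#> F. if u \<otimes> g \<in> C then Suc (col (u \<otimes> g)) else 0"
  shows "real (block_count F {shift G g x | g. g \<in> carrier G}) \<le> real (card (lab ` carrier G)) * K"
proof -
  define F' where "F' = set_inv W <#> F"
  have F': "finite F'" "F' \<subseteq> carrier G"
    unfolding F'_def using W F by (auto intro: finite_set_mult finite_set_inv dest: subsetD[OF set_mult_closed[OF set_inv_closed]])
  have lab: "lab g u = (if u \<otimes> g \<in> C then Suc (col (u \<otimes> g)) else 0)" if "u \<in> F'" for g u
    using that by (simp add: lab_def F'_def)
  have T: "T \<subseteq> carrier G" using TW W by blast
  \<comment> \<open>The labelling \<open>lab g\<close> records every centre \<open>c\<close> such that \<open>Wc\<close> meets \<open>Fg\<close>.\<close>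
  have seen: "c \<otimes> inv g \<in> F' \<and> lab g (c \<otimes> inv g) = Suc (col c)"
    if "g \<in> carrier G" "v \<in> F" "c \<in> C" "v \<otimes> g \<in> W #> c" for g v c
  proof -
    have cc: "c \<in> carrier G" "v \<in> carrier G" using that C F by auto
    have "v \<in> W #> (c \<otimes> inv g)" using translate_mem_iff[of W c g v] that W cc by simp
    then obtain w where w: "w \<in> W" "v = w \<otimes> (c \<otimes> inv g)" by (auto simp: r_coset_def)
    then have "c \<otimes> inv g \<in> F'"
      unfolding F'_def using mem_set_inv_mult_iff[of W F "c \<otimes> inv g"] W F cc that by auto
    then show ?thesis using cc that by (simp add: lab m_assoc)
  qed
  have recorded: "u \<otimes> g \<in> C \<and> col (u \<otimes> g) = lab g u - 1 \<and> u = (u \<otimes> g) \<otimes> inv g"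
    if "g \<in> carrier G" "u \<in> F'" "lab g u \<noteq> 0" for g u
    using that F' by (auto simp: lab m_assoc subset_iff split: if_splits)
  define E where "E \<sigma> = {v\<in>F. \<forall>u\<in>F'. \<sigma> u \<noteq> (0::nat) \<longrightarrow> v \<notin> W #> u}" for \<sigma>
  define B where "B \<sigma> = {v\<in>F. \<exists>u\<in>F'. \<sigma> u \<noteq> (0::nat) \<and> v \<in> (W #> u) - (T #> u)}" for \<sigma>
  have mem: "v \<otimes> g \<in> A #> (u \<otimes> g) \<longleftrightarrow> v \<in> A #> u"
    if "A \<subseteq> carrier G" "g \<in> carrier G" "u \<in> F'" "v \<in> F" for A u v g
    using translate_mem_iff[of A "u \<otimes> g" g v] that F' F by (simp add: m_assoc subset_iff)
  have E: "{v\<in>F. v \<otimes> g \<notin> W <#> C} = E (lab g)" if g: "g \<in> carrier G" for g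
  proof -
    have "v \<otimes> g \<in> W <#> C \<longleftrightarrow> (\<exists>u\<in>F'. lab g u \<noteq> 0 \<and> v \<in> W #> u)" if v: "v \<in> F" for v
    proof
      assume "v \<otimes> g \<in> W <#> C"
      then obtain c where c: "c \<in> C" "v \<otimes> g \<in> W #> c" by (auto simp: set_mult_def r_coset_def)
      have "v \<in> W #> (c \<otimes> inv g)" using translate_mem_iff[of W c g v] c g v W C F by blast
      then show "\<exists>u\<in>F'. lab g u \<noteq> 0 \<and> v \<in> W #> u" using seen[OF g v c] by (intro bexI[of _ "c \<otimes> inv g"]) auto
    next
      assume "\<exists>u\<in>F'. lab g u \<noteq> 0 \<and> v \<in> W #> u"
      then obtain u where u: "u \<in> F'" "lab g u \<noteq> 0" "v \<in> W #> u" by blast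
      then have "v \<otimes> g \<in> W #> (u \<otimes> g)" using mem[OF W(2) g u(1) v] by simp
      then show "v \<otimes> g \<in> W <#> C" using recorded[OF g u(1,2)] by (auto simp: set_mult_def r_coset_def)
    qed
    then show ?thesis unfolding E_def by auto
  qed
  have B: "{v\<in>F. \<exists>c\<in>C. v \<otimes> g \<in> (W #> c) - (T #> c)} = B (lab g)" if g: "g \<in> carrier G" for g
  proof -
    have "(\<exists>c\<in>C. v \<otimes> g \<in> (W #> c) - (T #> c)) \<longleftrightarrow> (\<exists>u\<in>F'. lab g u \<noteq> 0 \<and> v \<in> (W #> u) - (T #> u))"
      if v: "v \<in> F" for v
    proof
      assume "\<exists>c\<in>C. v \<otimes> g \<in> (W #> c) - (T #> c)"
      then obtain c where c: "c \<in> C" "v \<otimes> g \<in> W #> c" "v \<otimes> g \<notin> T #> c" by blast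
      have "v \<in> W #> (c \<otimes> inv g)" "v \<notin> T #> (c \<otimes> inv g)"
        using translate_mem_iff[of W c g v] translate_mem_iff[of T c g v] c g v W T C F by blast+
      then show "\<exists>u\<in>F'. lab g u \<noteq> 0 \<and> v \<in> (W #> u) - (T #> u)"
        using seen[OF g v c(1,2)] by (intro bexI[of _ "c \<otimes> inv g"]) simp_all
    next
      assume "\<exists>u\<in>F'. lab g u \<noteq> 0 \<and> v \<in> (W #> u) - (T #> u)"
      then obtain u where u: "u \<in> F'" "lab g u \<noteq> 0" "v \<in> W #> u" "v \<notin> T #> u" by blast
      then show "\<exists>c\<in>C. v \<otimes> g \<in> (W #> c) - (T #> c)"
        using mem[OF W(2) g u(1) v] mem[OF T g u(1) v] recorded[OF g u(1,2)] by blast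
    qed
    then show ?thesis unfolding B_def by auto
  qed
  define P where "P \<sigma> = {restrict (shift G g x) F | g. g \<in> carrier G \<and> lab g = \<sigma>}" for \<sigma>
  \<comment> \<open>Given the labels, a block is determined by its values on \<open>B\<close> and \<open>E\<close>: elsewhere the
    nearby tile of largest colour prescribes a value of \<open>a\<close>.\<close>
  have cardP: "real (card (P \<sigma>)) \<le> K" if \<sigma>: "\<sigma> \<in> lab ` carrier G" for \<sigma>
  proof -
    obtain g0 where g0: "\<sigma> = lab g0" "g0 \<in> carrier G" using \<sigma> by (rule imageE)
    have EF: "E \<sigma> \<subseteq> F" "B \<sigma> \<subseteq> F" by (auto simp: E_def B_def)
    have finEB: "finite (E \<sigma>)" "finite (B \<sigma>)" using EF F finite_subset by blast+
    let ?f = "\<lambda>p. (restrict p (B \<sigma>), restrict p (E \<sigma>))"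
    let ?R = "(B \<sigma> \<rightarrow>\<^sub>E \<Lambda>) \<times> occurring_blocks (E \<sigma>) Z"
    have elsewhere: "\<exists>u\<in>F'. \<forall>g\<in>carrier G. lab g = \<sigma> \<longrightarrow> x (v \<otimes> g) = a (v \<otimes> inv u)"
      if v: "v \<in> F" "v \<notin> B \<sigma>" "v \<notin> E \<sigma>" for v
    proof -
      let ?U = "{u\<in>F'. \<sigma> u \<noteq> 0 \<and> v \<in> W #> u}"
      have U: "finite ?U" "?U \<noteq> {}" using v F' by (auto simp: E_def)
      then have "Max (\<sigma> ` ?U) \<in> \<sigma> ` ?U" by (intro Max_in) auto
      then obtain u where u: "Max (\<sigma> ` ?U) = \<sigma> u" "u \<in> ?U" by (rule imageE)
      have umax: "\<sigma> u' \<le> \<sigma> u" if "u' \<in> ?U" for u'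
        unfolding u(1)[symmetric] using that U(1) by (intro Max_ge) auto
      have uT: "v \<in> T #> u" using u(2) v(1,2) by (auto simp: B_def)
      show ?thesis
      proof (intro bexI[of _ u] ballI impI)
        fix g assume g: "g \<in> carrier G" "lab g = \<sigma>"
        have uF: "u \<in> F'" "\<sigma> u \<noteq> 0" using u(2) by simp_all
        have rec: "u \<otimes> g \<in> C" "col (u \<otimes> g) = \<sigma> u - 1"
          using recorded[OF g(1) uF(1)] uF(2) g(2) by auto
        have "x (v \<otimes> g) = a ((v \<otimes> g) \<otimes> inv (u \<otimes> g))"
        proof (rule tile[OF rec(1)])
          show "v \<otimes> g \<in> T #> (u \<otimes> g)" using mem[OF T g(1) uF(1) v(1)] uT by simp
          fix c' assume c': "c' \<in> C" "col (u \<otimes> g) < col c'"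
          show "v \<otimes> g \<notin> W #> c'"
          proof
            assume wc: "v \<otimes> g \<in> W #> c'"
            note s = seen[OF g(1) v(1) c'(1) wc]
            have "c' \<in> carrier G" "v \<in> carrier G" using c'(1) v(1) C F by auto
            then have "v \<in> W #> (c' \<otimes> inv g)"
              using translate_mem_iff[OF W(2) _ g(1), of c' v] wc by simp
            then have "c' \<otimes> inv g \<in> ?U" using s g(2) by simp
            then have "\<sigma> (c' \<otimes> inv g) \<le> \<sigma> u" by (rule umax)
            moreover have "\<sigma> (c' \<otimes> inv g) = Suc (col c')" using s g(2) by simp
            ultimately show False using rec(2) c'(2) by simp
          qed
        qed
        also have "(v \<otimes> g) \<otimes> inv (u \<otimes> g) = v \<otimes> inv u"
        proof -
          have uv: "u \<in> carrier G" "v \<in> carrier G" using uF v F F' by auto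
          have "(v \<otimes> g) \<otimes> inv (u \<otimes> g) = v \<otimes> (g \<otimes> (inv g \<otimes> inv u))"
            using uv g(1) by (simp add: inv_mult_group m_assoc)
          also have "g \<otimes> (inv g \<otimes> inv u) = inv u" using uv g(1) by (simp flip: m_assoc)
          finally show ?thesis .
        qed
        finally show "x (v \<otimes> g) = a (v \<otimes> inv u)" .
      qed (use u(2) in simp)
    qed
    have inj: "inj_on ?f (P \<sigma>)"
    proof (rule inj_onI)
      fix p q assume "p \<in> P \<sigma>" "q \<in> P \<sigma>" and eq: "?f p = ?f q"
      then obtain g h where g: "g \<in> carrier G" "lab g = \<sigma>" "p = restrict (shift G g x) F"
        and h: "h \<in> carrier G" "lab h = \<sigma>" "q = restrict (shift G h x) F"
        unfolding P_def by blast
      have "p v = q v" if v: "v \<in> F" for v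
      proof (cases "v \<in> B \<sigma> \<union> E \<sigma>")
        case True
        have "restrict p (B \<sigma>) v = restrict q (B \<sigma>) v" "restrict p (E \<sigma>) v = restrict q (E \<sigma>) v"
          using eq by auto
        then show ?thesis using True by auto
      next
        case False
        then obtain u where "x (v \<otimes> g) = a (v \<otimes> inv u)" "x (v \<otimes> h) = a (v \<otimes> inv u)"
          using elsewhere[of v] v g h by blast
        then show ?thesis using v F g h by (simp add: shift_apply subset_iff)
      qed
      moreover have "p \<in> extensional F" "q \<in> extensional F" using g h by auto
      ultimately show "p = q" by (intro extensionalityI[of p F q])
    qed
    have sub: "?f ` P \<sigma> \<subseteq> ?R"
    proof (rule image_subsetI)
      fix p assume "p \<in> P \<sigma>"
      then obtain g where g: "g \<in> carrier G" "lab g = \<sigma>" "p = restrict (shift G g x) F"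
        unfolding P_def by blast
      have "restrict p (B \<sigma>) \<in> B \<sigma> \<rightarrow>\<^sub>E \<Lambda>"
        using g EF F symbolic_systemD(5)[OF X x] by (auto simp: shift_apply subset_iff)
      moreover have "restrict p (E \<sigma>) = restrict (shift G g z) (E \<sigma>)"
      proof (rule restrict_ext)
        fix v assume v: "v \<in> E \<sigma>"
        then have "v \<in> F" "v \<otimes> g \<notin> W <#> C" using E[OF g(1)] g by auto
        moreover have "v \<in> carrier G" using \<open>v \<in> F\<close> F by blast
        ultimately show "p v = shift G g z v" using g out[of "v \<otimes> g"] by (simp add: shift_apply)
      qed
      then have "restrict p (E \<sigma>) \<in> occurring_blocks (E \<sigma>) Z"
        using symbolic_systemD(4)[OF Z(1) g(1) Z(2)] by (auto simp: occurring_blocks_def)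
      ultimately show "?f p \<in> ?R" by blast
    qed
    have fin: "finite ?R"
      using finEB symbolic_systemD(1)[OF X] EF F
      by (intro finite_cartesian_product finite_PiE symbolic_system_finite_blocks[OF Z(1)]) auto
    have "card (P \<sigma>) \<le> card ?R" using card_inj_on_le[OF inj sub fin] .
    also have "card ?R = card \<Lambda> ^ card (B \<sigma>) * block_count (E \<sigma>) Z"
      using finEB by (simp add: card_cartesian_product card_PiE)
    finally have "real (card (P \<sigma>)) \<le> real (card \<Lambda> ^ card (B \<sigma>) * block_count (E \<sigma>) Z)"
      by (rule of_nat_mono)
    also have "\<dots> \<le> K" using K[OF g0(2)] unfolding E[OF g0(2)] B[OF g0(2)] g0(1) by simp
    finally show ?thesis .
  qed
  have finL: "finite (lab ` carrier G)"
  proof (rule finite_subset)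
    show "lab ` carrier G \<subseteq> F' \<rightarrow>\<^sub>E {..n}"
      using col by (auto simp: lab_def F'_def Suc_le_eq)
    show "finite (F' \<rightarrow>\<^sub>E {..n})" using F' by (intro finite_PiE) auto
  qed
  have "occurring_blocks F {shift G g x | g. g \<in> carrier G} = (\<Union>\<sigma>\<in>lab ` carrier G. P \<sigma>)"
    by (auto simp: occurring_blocks_def P_def)
  then have "real (block_count F {shift G g x | g. g \<in> carrier G}) \<le> real (\<Sum>\<sigma>\<in>lab ` carrier G. card (P \<sigma>))"
    using card_UN_le[OF finL, of P] by (simp only: of_nat_le_iff)
  also have "\<dots> = (\<Sum>\<sigma>\<in>lab ` carrier G. real (card (P \<sigma>)))" by simp
  also have "\<dots> \<le> (\<Sum>\<sigma>\<in>lab ` carrier G. K)" by (intro sum_mono cardP)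
  finally show ?thesis by simp
qed

end

text \<open>
  A Chernoff type bound for the number of labellings of \<open>V\<close> by \<open>{..n}\<close> with at most \<open>m\<close> nonzero
  labels: give the weight \<open>y = 1 / (n s)\<close> to each nonzero label. Every sparse labelling then weighs at
  least \<open>y ^ m\<close>, and all labellings together weigh \<open>(1 + n y) ^ card V\<close>.
\<close>
lemma card_sparse_labellings:
  fixes s :: real and n :: nat
  assumes V: "finite V" and L: "L \<subseteq> V \<rightarrow>\<^sub>E {..n}"
    and sparse: "\<And>\<sigma>. \<sigma> \<in> L \<Longrightarrow> card {u\<in>V. \<sigma> u \<noteq> 0} \<le> m"
    and s: "s \<ge> 1" and n: "n \<ge> 1"
  shows "real (card L) \<le> (1 + 1 / s) ^ card V * (n * s) ^ m"
proof -
  define y where "y = 1 / (n * s)"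
  have ns: "n * s \<ge> 1" using s n mult_mono[of 1 "real n" 1 s] by simp
  have y: "0 < y" "y \<le> 1" using ns by (auto simp: y_def)
  define w where "w i = (if i = (0::nat) then 1 else y)" for i
  have fin: "finite (V \<rightarrow>\<^sub>E {..n})" using V by (intro finite_PiE) auto
  have "real (card L) * y ^ m = (\<Sum>\<sigma>\<in>L. y ^ m)" by simp
  also have "\<dots> \<le> (\<Sum>\<sigma>\<in>L. \<Prod>u\<in>V. w (\<sigma> u))"
  proof (rule sum_mono)
    fix \<sigma> assume "\<sigma> \<in> L"
    have "(\<Prod>u\<in>V. w (\<sigma> u)) = (\<Prod>u\<in>{u\<in>V. \<sigma> u \<noteq> 0}. y)"
      by (rule prod.mono_neutral_cong_right[OF V]) (auto simp: w_def)
    also have "\<dots> \<ge> y ^ m"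
      using sparse[OF \<open>\<sigma> \<in> L\<close>] y by (simp add: power_decreasing)
    finally show "y ^ m \<le> (\<Prod>u\<in>V. w (\<sigma> u))" .
  qed
  also have "\<dots> \<le> (\<Sum>\<sigma>\<in>V \<rightarrow>\<^sub>E {..n}. \<Prod>u\<in>V. w (\<sigma> u))"
    using y by (intro sum_mono2[OF fin L] prod_nonneg) (auto simp: w_def)
  also have "\<dots> = (\<Prod>u\<in>V. \<Sum>i\<in>{..n}. w i)"
    by (rule prod_sum_PiE[symmetric]) (use V in auto)
  also have "(\<Sum>i\<in>{..n}. w i) = 1 + n * y"
    by (simp add: w_def sum.atMost_shift)
  also have "n * y = 1 / s" using n by (simp add: y_def)
  finally have "real (card L) * y ^ m \<le> (1 + 1 / s) ^ card V" by simp
  then have "real (card L) \<le> (1 + 1 / s) ^ card V / y ^ m"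
    using y by (simp add: pos_le_divide_eq)
  then show ?thesis by (simp add: y_def power_divide)
qed

section \<open>Subsystems of small entropy\<close>

text \<open>
  The cost per position of recording centres and colours when the tiles have \<open>s\<close> elements: at most
  \<open>4 / s\<close> centres per position, each with one of \<open>9 s ^ 2\<close> colours. The power \<open>s ^ 3\<close> accounts in
  addition for the place of the centre.
\<close>
lemma log_label_cost_tendsto_0: "((\<lambda>s::real. 4 / s + 4 / s * log 2 (9 * s ^ 3)) \<longlongrightarrow> 0) at_top"
  by real_asymp

lemma log2_one_plus_le:
  fixes t :: real assumes "t \<ge> 0" shows "log 2 (1 + t) \<le> 2 * t"
proof -
  have "ln 2 \<ge> (1/2 :: real)" using ln2_ge_two_thirds by simp
  have "ln (1 + t) \<le> t" using assms by (rule ln_add_one_self_le_self)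
  also have "t \<le> 2 * t * ln 2" using mult_left_mono[OF \<open>ln 2 \<ge> 1/2\<close>, of "2 * t"] assms by simp
  finally show ?thesis by (simp add: log_def pos_divide_le_eq)
qed

context group
begin

text \<open>
  Each tile close to the window contributes at most a translate of \<open>W - T\<close>.
\<close>
lemma card_boundary_positions_le:
  assumes W: "finite W" "W \<subseteq> carrier G" "T \<subseteq> W" and F: "finite F" "F \<subseteq> carrier G"
    and C: "C \<subseteq> carrier G" and g: "g \<in> carrier G"
  shows "card {v\<in>F. \<exists>c\<in>C. v \<otimes> g \<in> (W #> c) - (T #> c)}
    \<le> card (C \<inter> ((set_inv W <#> F) #> g)) * card (W - T)"
proof -
  let ?C = "C \<inter> ((set_inv W <#> F) #> g)"
  let ?B = "\<lambda>c. {v\<in>F. v \<otimes> g \<in> (W #> c) - (T #> c)}"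
  have T: "T \<subseteq> carrier G" using W by blast
  have F': "finite (set_inv W <#> F)" "set_inv W <#> F \<subseteq> carrier G"
    using W F by (intro finite_set_mult finite_set_inv set_mult_closed set_inv_closed; simp)+
  have finC: "finite ?C" using F' by (simp add: r_coset_def)
  have "{v\<in>F. \<exists>c\<in>C. v \<otimes> g \<in> (W #> c) - (T #> c)} \<subseteq> (\<Union>c\<in>?C. ?B c)"
  proof
    fix v assume "v \<in> {v\<in>F. \<exists>c\<in>C. v \<otimes> g \<in> (W #> c) - (T #> c)}"
    then obtain c where v: "v \<in> F" and c: "c \<in> C" "v \<otimes> g \<in> W #> c" "v \<otimes> g \<notin> T #> c" by blast
    have cc: "c \<in> carrier G" "v \<in> carrier G" using c C v F by auto
    have "v \<in> W #> (c \<otimes> inv g)" using translate_mem_iff[OF W(2) cc(1) g cc(2)] c by simp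
    then obtain w where "w \<in> W" "v = w \<otimes> (c \<otimes> inv g)" by (auto simp: r_coset_def)
    then have "c \<otimes> inv g \<in> set_inv W <#> F"
      using mem_set_inv_mult_iff[of W F "c \<otimes> inv g"] W F cc g v by auto
    then have "c \<in> (set_inv W <#> F) #> g" using mem_r_coset_iff[OF F'(2) g cc(1)] by simp
    then show "v \<in> (\<Union>c\<in>?C. ?B c)" using v c by blast
  qed
  then have "card {v\<in>F. \<exists>c\<in>C. v \<otimes> g \<in> (W #> c) - (T #> c)} \<le> card (\<Union>c\<in>?C. ?B c)"
    using finC F by (intro card_mono) auto
  also have "\<dots> \<le> (\<Sum>c\<in>?C. card (?B c))" by (rule card_UN_le[OF finC])
  also have "\<dots> \<le> (\<Sum>c\<in>?C. card (W - T))"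
  proof (rule sum_mono)
    fix c assume "c \<in> ?C"
    then have c: "c \<in> carrier G" using C by blast
    show "card (?B c) \<le> card (W - T)"
    proof (rule card_inj_on_le[of "\<lambda>v. v \<otimes> g \<otimes> inv c"])
      show "inj_on (\<lambda>v. v \<otimes> g \<otimes> inv c) (?B c)"
      proof (rule inj_onI)
        fix u v assume "u \<in> ?B c" "v \<in> ?B c" "u \<otimes> g \<otimes> inv c = v \<otimes> g \<otimes> inv c"
        then show "u = v" using F c g by (auto simp: subset_iff)
      qed
      show "(\<lambda>v. v \<otimes> g \<otimes> inv c) ` ?B c \<subseteq> W - T"
      proof (rule image_subsetI)
        fix v assume v: "v \<in> ?B c"
        then have "v \<otimes> g \<in> carrier G" using F g by auto
        then show "v \<otimes> g \<otimes> inv c \<in> W - T"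
          using v mem_r_coset_iff[OF W(2) c] mem_r_coset_iff[OF T c] by simp
      qed
    qed (use W in simp)
  qed
  finally show ?thesis by simp
qed

text \<open>
  The uncovered part \<open>E\<close> of the window enters Shearer's inequality through \<open>set_inv T0 <#> E\<close>, the set of
  \<open>h\<close> such that \<open>T0 h\<close> meets \<open>E\<close>. If \<open>hg\<close> lies in \<open>SC\<close>, then \<open>T0 hg\<close> lies in \<open>WC\<close>, so \<open>h\<close> is not of this
  kind; hence only the half of the window outside \<open>SC\<close>, and boundary terms, remain. This is why the
  tiles are thickened by \<open>T0\<close>.
\<close>
lemma card_touching_uncovered_le:
  assumes S: "finite S" "S \<subseteq> carrier G" and T0: "finite T0" "T0 \<subseteq> carrier G"
    and W: "T0 <#> S \<subseteq> W" and F: "finite F" "F \<subseteq> carrier G"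
    and C: "C \<subseteq> carrier G" and g: "g \<in> carrier G"
    and cover: "\<And>F. finite F \<Longrightarrow> F \<subseteq> carrier G \<Longrightarrow>
      2 * card (F - (S <#> C)) \<le> card F + 2 * card ((S <#> F) - F)"
  shows "2 * card (set_inv T0 <#> {v\<in>F. v \<otimes> g \<notin> W <#> C})
    \<le> card F + 2 * card ((S <#> F) - F) + 2 * card ((set_inv T0 <#> F) - F)"
proof -
  let ?E = "{v\<in>F. v \<otimes> g \<notin> W <#> C}" and ?H = "{h\<in>F. h \<otimes> g \<notin> S <#> C}"
  have sub: "set_inv T0 <#> ?E \<subseteq> ?H \<union> ((set_inv T0 <#> F) - F)"
  proof
    fix h assume h: "h \<in> set_inv T0 <#> ?E"
    then have hF: "h \<in> set_inv T0 <#> F" by (auto simp: set_mult_def)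
    then have hc: "h \<in> carrier G" using set_mult_closed[OF set_inv_closed[OF T0(2)] F(2)] by blast
    obtain t where t: "t \<in> T0" "t \<otimes> h \<otimes> g \<notin> W <#> C"
      using h mem_set_inv_mult_iff[OF T0(2) _ hc, of ?E] F by auto
    have "h \<otimes> g \<notin> S <#> C"
    proof
      assume "h \<otimes> g \<in> S <#> C"
      then obtain s c where sc: "s \<in> S" "c \<in> C" "h \<otimes> g = s \<otimes> c" by (auto simp: set_mult_def)
      have cc: "t \<in> carrier G" "s \<in> carrier G" "c \<in> carrier G" using t sc T0 S C by auto
      then have "t \<otimes> h \<otimes> g = t \<otimes> s \<otimes> c" using sc(3) hc g by (simp add: m_assoc)
      moreover have "t \<otimes> s \<in> T0 <#> S" using t(1) sc(1) by (auto simp: set_mult_def)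
      then have "t \<otimes> s \<in> W" using W by blast
      ultimately have "t \<otimes> h \<otimes> g \<in> W <#> C" using sc(2) by (auto simp: set_mult_def)
      then show False using t by simp
    qed
    then show "h \<in> ?H \<union> ((set_inv T0 <#> F) - F)" using hF by auto
  qed
  have fin: "finite (set_inv T0 <#> F)" using T0 F by (intro finite_set_mult finite_set_inv)
  have "card (set_inv T0 <#> ?E) \<le> card (?H \<union> ((set_inv T0 <#> F) - F))"
    using sub fin F by (intro card_mono) auto
  also have "\<dots> \<le> card ?H + card ((set_inv T0 <#> F) - F)" by (rule card_Un_le)
  finally have 1: "card (set_inv T0 <#> ?E) \<le> card ?H + card ((set_inv T0 <#> F) - F)" .
  have Fg: "finite (F #> g)" "F #> g \<subseteq> carrier G" using F g r_coset_subset_G by (auto simp: r_coset_def)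
  have "card ?H \<le> card ((F #> g) - (S <#> C))"
  proof (rule card_inj_on_le[of "\<lambda>v. v \<otimes> g"])
    show "inj_on (\<lambda>v. v \<otimes> g) ?H"
    proof (rule inj_onI)
      fix u v assume "u \<in> ?H" "v \<in> ?H" "u \<otimes> g = v \<otimes> g"
      then show "u = v" using F g by (auto simp: subset_iff)
    qed
    show "(\<lambda>v. v \<otimes> g) ` ?H \<subseteq> (F #> g) - (S <#> C)" by (auto simp: r_coset_def)
  qed (use Fg in simp)
  moreover have "2 * card ((F #> g) - (S <#> C)) \<le> card (F #> g) + 2 * card ((S <#> (F #> g)) - (F #> g))"
    by (rule cover[OF Fg])
  moreover have "card (F #> g) = card F" using F g by (intro card_r_coset)
  moreover have "card ((S <#> (F #> g)) - (F #> g)) \<le> card ((S <#> F) - F)"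
  proof -
    have "(S <#> (F #> g)) - (F #> g) \<subseteq> ((S <#> F) - F) #> g"
      unfolding setmult_rcos_assoc[OF S(2) F(2) g] by (auto simp: r_coset_def)
    moreover have "finite (((S <#> F) - F) #> g)" using S F by (simp add: r_coset_def finite_set_mult)
    moreover have "card (((S <#> F) - F) #> g) = card ((S <#> F) - F)"
      using set_mult_closed[OF S(2) F(2)] g by (intro card_r_coset) auto
    ultimately show ?thesis using card_mono by metis
  qed
  ultimately show ?thesis using 1 by linarith
qed

text \<open>
  \<open>Tc\<close> meets \<open>Wc'\<close> only if \<open>c\<close> lies in \<open>(set_inv T <#> W)c'\<close>, so a tile is in conflict with boundedly
  many others and a colouring with polynomially many colours separates the tiles of each colour.
\<close>
lemma tile_colouring:
  assumes T: "finite T" "T \<subseteq> carrier G" and W: "finite W" "W \<subseteq> carrier G"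
    and C: "C \<subseteq> carrier G" and count: "countable (carrier G)"
  obtains col where "\<And>c. c \<in> C \<Longrightarrow> col c \<le> 2 * card T * card W"
    "\<And>c c'. c \<in> C \<Longrightarrow> c' \<in> C \<Longrightarrow> c \<noteq> c' \<Longrightarrow> col c = (col c' :: nat) \<Longrightarrow> (T #> c) \<inter> (W #> c') = {}"
proof -
  define adj where "adj u v \<longleftrightarrow> (T #> u) \<inter> (W #> v) \<noteq> {} \<or> (T #> v) \<inter> (W #> u) \<noteq> {}" for u v
  have diff: "u \<in> (set_inv A <#> B) #> v"
    if "A \<subseteq> carrier G" "B \<subseteq> carrier G" "u \<in> carrier G" "v \<in> carrier G" and meet: "(A #> u) \<inter> (B #> v) \<noteq> {}"
    for A B u v
  proof -
    obtain a b where ab: "a \<in> A" "b \<in> B" "a \<otimes> u = b \<otimes> v" using meet by (auto simp: r_coset_def)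
    have c: "a \<in> carrier G" "b \<in> carrier G" using ab that by auto
    then have "u = inv a \<otimes> (a \<otimes> u)" using that by (simp flip: m_assoc)
    also have "\<dots> = inv a \<otimes> b \<otimes> v" unfolding ab(3) using c that by (simp add: m_assoc)
    finally show ?thesis using ab by (auto simp: r_coset_def set_mult_def SET_INV_def)
  qed
  have deg: "finite {u\<in>C. adj u v} \<and> card {u\<in>C. adj u v} \<le> 2 * card T * card W" if v: "v \<in> C" for v
  proof -
    let ?N = "((set_inv T <#> W) #> v) \<union> ((set_inv W <#> T) #> v)"
    have vc: "v \<in> carrier G" using v C by blast
    have sub: "{u\<in>C. adj u v} \<subseteq> ?N"
      using diff[OF T(2) W(2) _ vc] diff[OF W(2) T(2) _ vc] C unfolding adj_def by blast
    have cl: "set_inv T <#> W \<subseteq> carrier G" "set_inv W <#> T \<subseteq> carrier G"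
      using T W by (intro set_mult_closed set_inv_closed; simp)+
    have fin: "finite ?N" using T W by (simp add: r_coset_def finite_set_mult finite_set_inv)
    have "card ((set_inv T <#> W) #> v) \<le> card T * card W"
    proof -
      have "card ((set_inv T <#> W) #> v) = card (set_inv T <#> W)" using cl vc by (intro card_r_coset)
      also have "\<dots> \<le> card (set_inv T) * card W" using T W by (intro card_set_mult_le finite_set_inv)
      also have "\<dots> \<le> card T * card W" using card_set_inv[OF T(1)] by simp
      finally show ?thesis .
    qed
    moreover have "card ((set_inv W <#> T) #> v) \<le> card T * card W"
    proof -
      have "card ((set_inv W <#> T) #> v) = card (set_inv W <#> T)" using cl vc by (intro card_r_coset)
      also have "\<dots> \<le> card (set_inv W) * card T" using T W by (intro card_set_mult_le finite_set_inv)
      also have "\<dots> \<le> card T * card W" using card_set_inv[OF W(1)] by simp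
      finally show ?thesis .
    qed
    ultimately have "card ?N \<le> 2 * card T * card W"
      using card_Un_le[of "(set_inv T <#> W) #> v" "(set_inv W <#> T) #> v"] by linarith
    then show ?thesis using card_mono[OF fin sub] finite_subset[OF sub fin] by simp
  qed
  have "\<exists>col. (\<forall>v\<in>C. col v \<le> 2 * card T * card W) \<and>
      (\<forall>u\<in>C. \<forall>v\<in>C. u \<noteq> v \<longrightarrow> adj u v \<longrightarrow> col u \<noteq> (col v :: nat))"
    using countable_subset[OF C count] deg by (rule bounded_degree_colouring) (auto simp: adj_def)
  then obtain col where col: "(\<forall>v\<in>C. col v \<le> 2 * card T * card W) \<and>
      (\<forall>u\<in>C. \<forall>v\<in>C. u \<noteq> v \<longrightarrow> adj u v \<longrightarrow> col u \<noteq> (col v :: nat))" ..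
  show ?thesis
  proof (rule that[of col])
    show "col c \<le> 2 * card T * card W" if "c \<in> C" for c using col that by simp
    show "(T #> c) \<inter> (W #> c') = {}" if "c \<in> C" "c' \<in> C" "c \<noteq> c'" "col c = col c'" for c c'
    proof -
      have "\<not> adj c c'" using conjunct2[OF col, rule_format, OF that(1,2,3)] that(4) by auto
      then show ?thesis by (simp add: adj_def)
    qed
  qed
qed

text \<open>
  Every subsystem \<open>Z\<close> of \<open>X\<close> can be replaced by one with at most three quarters of its entropy (up to
  measuring entropy by a single finite set, which by Shearer's inequality bounds it). The new
  subsystem is generated by a point \<open>z\<close> of \<open>Z\<close> in which a fixed pattern is written on tiles that cover
  half of the group. On the other half the point still looks like \<open>Z\<close>, which costs half of the old
  entropy; the remaining quarter pays for tile boundaries, window boundaries and the labels.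
\<close>
lemma low_entropy_step:
  assumes am: "amenable G" and inf: "infinite (carrier G)" and count: "countable (carrier G)"
    and X: "symbolic_system G \<Lambda> X" and D: "gluing_set G D X"
    and Z: "symbolic_system G \<Lambda> Z" "Z \<subseteq> X" "Z \<noteq> {}"
    and T0: "finite T0" "T0 \<subseteq> carrier G" "T0 \<noteq> {}"
    and a: "a > (0::real)" "log 2 (block_count T0 Z) \<le> a * card T0"
  shows "\<exists>Z' F. symbolic_system G \<Lambda> Z' \<and> Z' \<subseteq> X \<and> Z' \<noteq> {} \<and>
    finite F \<and> F \<subseteq> carrier G \<and> F \<noteq> {} \<and> log 2 (block_count F Z') \<le> (3 / 4 * a) * card F"
proof -
  note Dp = gluing_setD[OF D]
  obtain \<Phi> where \<Phi>: "folner_sequence G \<Phi>" using am by (auto simp: amenable_def)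
  obtain z where z: "z \<in> Z" using Z by blast
  have zX: "z \<in> X" using z Z by blast
  have "z \<one> \<in> \<Lambda>" using symbolic_systemD(5)[OF X zX] by simp
  then have "card \<Lambda> \<ge> 1" using symbolic_systemD(1)[OF X] by (metis One_nat_def Suc_leI card_gt_0_iff empty_iff)
  define l where "l = log 2 (real (card \<Lambda>))"
  have l0: "l \<ge> 0" using \<open>card \<Lambda> \<ge> 1\<close> by (simp add: l_def)
  have powl: "real (card \<Lambda>) = 2 powr l" using \<open>card \<Lambda> \<ge> 1\<close> by (simp add: l_def)
  \<comment> \<open>The error terms are \<open>4 \<eta> l\<close> (tile boundaries), \<open>2 \<eta> a\<close> (window boundaries) and the cost of
    recording the labels; together they stay below \<open>a / 4\<close>.\<close>
  define \<eta> where "\<eta> = min 1 (a / (32 * (l + a)))"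
  have \<eta>: "\<eta> > 0" "\<eta> \<le> 1" using a l0 by (auto simp: \<eta>_def)
  have \<eta>_small: "4 * \<eta> * l + 2 * \<eta> * a \<le> a / 8"
  proof -
    have "\<eta> \<le> a / (32 * (l + a))" by (simp add: \<eta>_def)
    then have "\<eta> * (32 * (l + a)) \<le> a" using a l0 by (simp add: pos_le_divide_eq)
    then have "32 * (\<eta> * l) + 32 * (\<eta> * a) \<le> a" by (simp add: algebra_simps)
    moreover have "0 \<le> \<eta> * l" "0 \<le> \<eta> * a" using \<eta> l0 a by auto
    ultimately show ?thesis unfolding mult.assoc by linarith
  qed
  have "\<forall>\<^sub>F s in at_top. 4 / s + 4 / s * log 2 (9 * s ^ 3) < a / 8"
    using a by (intro order_tendstoD(2)[OF log_label_cost_tendsto_0]) auto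
  then obtain s0 where s0: "\<And>s. s \<ge> s0 \<Longrightarrow> 4 / s + 4 / s * log 2 (9 * s ^ 3) < a / 8"
    by (auto simp: eventually_at_top_linorder)

  \<comment> \<open>\<open>S\<close> is a large Folner set, almost invariant under \<open>U = D T0'\<close>. The pattern is written on
    translates of \<open>T = T0' S\<close>, and gluing disturbs the translates of \<open>W = D T\<close>; all three have
    almost the same size.\<close>
  define T0' where "T0' = insert \<one> T0"
  define U where "U = D <#> T0'"
  have T0': "finite T0'" "T0' \<subseteq> carrier G" "\<one> \<in> T0'" using T0 by (auto simp: T0'_def)
  have U: "finite U" "U \<subseteq> carrier G"
    unfolding U_def using Dp T0' by (intro finite_set_mult set_mult_closed; simp)+
  have "\<forall>\<^sub>F n in sequentially. (real (card ((U <#> \<Phi> n) - \<Phi> n)) \<le> \<eta> * card (\<Phi> n)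
    \<and> real (card (U <#> \<Phi> n)) \<le> (1 + \<eta>) * card (\<Phi> n)) \<and> card (\<Phi> n) \<ge> nat \<lceil>s0\<rceil>"
    using eventually_conj[OF folner_eventually_invariant[OF \<Phi> U \<eta>(1)]
        folner_card_at_top[OF \<Phi> inf, unfolded filterlim_at_top, rule_format]] .
  then obtain n where n: "real (card ((U <#> \<Phi> n) - \<Phi> n)) \<le> \<eta> * card (\<Phi> n)"
      "real (card (U <#> \<Phi> n)) \<le> (1 + \<eta>) * card (\<Phi> n)" "card (\<Phi> n) \<ge> nat \<lceil>s0\<rceil>"
    by (auto simp: eventually_sequentially)
  define S where "S = \<Phi> n"
  define s where "s = card S"
  have S: "finite S" "S \<subseteq> carrier G" "S \<noteq> {}" "s \<ge> 1"
    using folner_sequenceD[OF \<Phi>, of n] by (auto simp: S_def s_def Suc_le_eq)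
  have s: "real (card ((U <#> S) - S)) \<le> \<eta> * s" "real (card (U <#> S)) \<le> 2 * s" "real s \<ge> s0"
  proof -
    show "real (card ((U <#> S) - S)) \<le> \<eta> * s" using n by (simp add: S_def s_def)
    have "(1 + \<eta>) * real s \<le> 2 * real s" using \<eta> by (intro mult_right_mono) auto
    then show "real (card (U <#> S)) \<le> 2 * s" using n by (simp add: S_def s_def)
    show "real s \<ge> s0" using n by (simp add: S_def s_def nat_ceiling_le_eq)
  qed
  define T where "T = T0' <#> S"
  define W where "W = D <#> T"
  have T: "finite T" "T \<subseteq> carrier G"
    unfolding T_def using T0' S by (intro finite_set_mult set_mult_closed; simp)+
  have WU: "W = U <#> S" unfolding W_def T_def U_def using set_mult_assoc[OF Dp(1) T0'(2) S(2)] by simp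
  have W: "finite W" "W \<subseteq> carrier G"
    unfolding W_def using Dp T by (intro finite_set_mult set_mult_closed; simp)+
  have ST: "S \<subseteq> T" unfolding T_def by (rule subset_set_mult_one[OF T0'(3) S(2)])
  have TW: "T \<subseteq> W" unfolding W_def by (rule subset_set_mult_one[OF Dp(3) T(2)])
  have cardW: "card W \<le> 2 * s" using s(2) unfolding WU by linarith
  have cardT: "card T \<le> 2 * s" using card_mono[OF W(1) TW] cardW by linarith
  have cardWT: "real (card (W - T)) \<le> \<eta> * s"
  proof -
    have "card (W - T) \<le> card ((U <#> S) - S)" using W ST unfolding WU by (intro card_mono) auto
    then show ?thesis using s(1) by linarith
  qed

  obtain C where C: "C \<subseteq> carrier G"
    and cover: "\<And>F. finite F \<Longrightarrow> F \<subseteq> carrier G \<Longrightarrow> 2 * card (F - (S <#> C)) \<le> card F + 2 * card ((S <#> F) - F)"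
    and dens: "\<And>F. finite F \<Longrightarrow> F \<subseteq> carrier G \<Longrightarrow> card (C \<inter> F) * s \<le> 2 * card (S <#> F)"
    unfolding s_def using half_cover[OF S(1-3)] by blast
  obtain col where col: "\<And>c. c \<in> C \<Longrightarrow> col c \<le> 2 * card T * card W"
    and proper: "\<And>c c'. c \<in> C \<Longrightarrow> c' \<in> C \<Longrightarrow> c \<noteq> c' \<Longrightarrow> col c = (col c' :: nat) \<Longrightarrow> (T #> c) \<inter> (W #> c') = {}"
    using tile_colouring[OF T W C count] by blast
  define q where "q = 8 * s ^ 2 + 1"
  have colq: "col c < q" if "c \<in> C" for c
  proof -
    have "2 * card T * card W \<le> 2 * (2 * s) * (2 * s)" using cardW cardT by (intro mult_le_mono) auto
    then show ?thesis using col[OF that] by (simp add: q_def power2_eq_square)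
  qed

  define Cs where "Cs i = {c \<in> C. col c = i}" for i
  have sep: "(T #> c) \<inter> (D <#> (T #> c')) = {}" if "c \<in> Cs i" "c' \<in> Cs i" "c \<noteq> c'" for i c c'
  proof -
    have "D <#> (T #> c') = W #> c'"
      unfolding W_def using that C Dp T by (intro setmult_rcos_assoc) (auto simp: Cs_def)
    then show ?thesis using proper[of c c'] that by (simp add: Cs_def)
  qed
  have "\<exists>x\<in>X. (\<forall>v\<in>carrier G. (\<forall>i<q. v \<notin> (D <#> T) <#> Cs i) \<longrightarrow> x v = z v) \<and>
    (\<forall>i<q. \<forall>c\<in>Cs i. \<forall>v\<in>T #> c. (\<forall>j. i < j \<longrightarrow> j < q \<longrightarrow> v \<notin> (D <#> T) <#> Cs j) \<longrightarrow> x v = z (v \<otimes> inv c))"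
    using C sep by (intro overwrite_tiles[OF X D zX zX T(2)]) (auto simp: Cs_def)
  then obtain x where x: "x \<in> X"
    and xz: "\<And>v. v \<in> carrier G \<Longrightarrow> (\<And>i. i < q \<Longrightarrow> v \<notin> W <#> Cs i) \<Longrightarrow> x v = z v"
    and xt: "\<And>i c v. i < q \<Longrightarrow> c \<in> Cs i \<Longrightarrow> v \<in> T #> c \<Longrightarrow>
      (\<And>j. i < j \<Longrightarrow> j < q \<Longrightarrow> v \<notin> W <#> Cs j) \<Longrightarrow> x v = z (v \<otimes> inv c)"
    unfolding W_def by blast
  have out: "x v = z v" if "v \<in> carrier G" "v \<notin> W <#> C" for v
    using that by (intro xz) (auto simp: set_mult_def Cs_def)
  have tile: "x v = z (v \<otimes> inv c)"
    if "c \<in> C" "v \<in> T #> c" "\<And>c'. c' \<in> C \<Longrightarrow> col c < col c' \<Longrightarrow> v \<notin> W #> c'" for c v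
  proof (rule xt[OF colq[OF that(1)] _ that(2)])
    show "v \<notin> W <#> Cs j" if "col c < j" for j
      using that \<open>\<And>c'. c' \<in> C \<Longrightarrow> col c < col c' \<Longrightarrow> v \<notin> W #> c'\<close>
      by (auto simp: set_mult_def r_coset_def Cs_def)
  qed (use that in \<open>simp add: Cs_def\<close>)

  \<comment> \<open>The window \<open>F\<close>, almost invariant under everything above, in which the blocks of \<open>x\<close> are
    counted.\<close>
  let ?SW = "S <#> set_inv W"
  have SW: "finite ?SW" "?SW \<subseteq> carrier G"
    using S W by (intro finite_set_mult finite_set_inv set_mult_closed set_inv_closed; simp)+
  have iW: "finite (set_inv W)" "set_inv W \<subseteq> carrier G" using W by (intro finite_set_inv set_inv_closed; simp)+
  have iT0: "finite (set_inv T0)" "set_inv T0 \<subseteq> carrier G" using T0 by (intro finite_set_inv set_inv_closed; simp)+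
  have "\<forall>\<^sub>F n in sequentially. real (card (?SW <#> \<Phi> n)) \<le> (1 + 1) * card (\<Phi> n) \<and>
    real (card (set_inv W <#> \<Phi> n)) \<le> (1 + 1) * card (\<Phi> n) \<and>
    real (card ((set_inv T0 <#> \<Phi> n) - \<Phi> n)) \<le> \<eta> * card (\<Phi> n) \<and>
    real (card ((S <#> \<Phi> n) - \<Phi> n)) \<le> \<eta> * card (\<Phi> n)"
    using folner_eventually_invariant[OF \<Phi> SW, of 1] folner_eventually_invariant[OF \<Phi> iW, of 1]
      folner_eventually_invariant[OF \<Phi> iT0 \<eta>(1)] folner_eventually_invariant[OF \<Phi> S(1,2) \<eta>(1)]
    by (simp add: eventually_conj_iff)
  then obtain k where k: "real (card (?SW <#> \<Phi> k)) \<le> (1 + 1) * card (\<Phi> k)"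
    "real (card (set_inv W <#> \<Phi> k)) \<le> (1 + 1) * card (\<Phi> k)"
    "real (card ((set_inv T0 <#> \<Phi> k) - \<Phi> k)) \<le> \<eta> * card (\<Phi> k)"
    "real (card ((S <#> \<Phi> k) - \<Phi> k)) \<le> \<eta> * card (\<Phi> k)"
    by (auto simp: eventually_sequentially)
  define F where "F = \<Phi> k"
  define f where "f = card F"
  have F: "finite F" "F \<subseteq> carrier G" "F \<noteq> {}" "f > 0"
    using folner_sequenceD[OF \<Phi>, of k] by (auto simp: F_def f_def)
  define F' where "F' = set_inv W <#> F"
  have F': "finite F'" "F' \<subseteq> carrier G"
    unfolding F'_def using iW F by (intro finite_set_mult set_mult_closed; simp)+
  have kF: "card (S <#> F') \<le> 2 * f" "card F' \<le> 2 * f"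
    "real (card ((set_inv T0 <#> F) - F)) \<le> \<eta> * f" "real (card ((S <#> F) - F)) \<le> \<eta> * f"
  proof -
    have "S <#> F' = ?SW <#> F" unfolding F'_def using set_mult_assoc[OF S(2) iW(2) F(2)] by simp
    then show "card (S <#> F') \<le> 2 * f" "card F' \<le> 2 * f"
      "real (card ((set_inv T0 <#> F) - F)) \<le> \<eta> * f" "real (card ((S <#> F) - F)) \<le> \<eta> * f"
      using k unfolding F_def f_def F'_def by simp_all
  qed

  define m where "m = (4 * f) div s"
  have ms: "m * s \<le> 4 * f" by (simp add: m_def)
  have few: "card (C \<inter> (F' #> g)) \<le> m" if g: "g \<in> carrier G" for g
  proof -
    have "finite (F' #> g)" "F' #> g \<subseteq> carrier G" using F' g r_coset_subset_G by (auto simp: r_coset_def)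
    then have "card (C \<inter> (F' #> g)) * s \<le> 2 * card (S <#> (F' #> g))" by (rule dens)
    also have "S <#> (F' #> g) = (S <#> F') #> g" using S F' g by (intro setmult_rcos_assoc)
    also have "card \<dots> = card (S <#> F')" using S F' g by (intro card_r_coset set_mult_closed)
    finally have "card (C \<inter> (F' #> g)) * s \<le> 4 * f" using kF(1) by linarith
    then show ?thesis using S(4) by (simp add: m_def less_eq_div_iff_mult_less_eq)
  qed

  define K where "K = 2 powr ((4 * \<eta> * l + 2 * \<eta> * a + a / 2) * f)"
  have K: "real (card \<Lambda>) ^ card {v\<in>F. \<exists>c\<in>C. v \<otimes> g \<in> (W #> c) - (T #> c)} *
        real (block_count {v\<in>F. v \<otimes> g \<notin> W <#> C} Z) \<le> K" (is "_ ^ card ?B * real (block_count ?E Z) \<le> _")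
    if g: "g \<in> carrier G" for g
  proof -
    have "card ?B \<le> card (C \<inter> (F' #> g)) * card (W - T)"
      unfolding F'_def by (rule card_boundary_positions_le[OF W TW F(1,2) C g])
    also have "\<dots> \<le> m * card (W - T)" using few[OF g] by simp
    finally have "real (card ?B) \<le> real (m * card (W - T))" by (rule of_nat_mono)
    also have "\<dots> = real m * real (card (W - T))" by simp
    also have "\<dots> \<le> real m * (\<eta> * s)" using cardWT by (intro mult_left_mono) auto
    also have "\<dots> = \<eta> * real (m * s)" by simp
    also have "\<dots> \<le> \<eta> * real (4 * f)" using \<eta> ms by (intro mult_left_mono of_nat_mono) auto
    finally have "real (card ?B) \<le> 4 * \<eta> * f" by simp
    then have B: "real (card ?B) * l \<le> 4 * \<eta> * f * l" using l0 by (rule mult_right_mono)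
    have E: "finite ?E" "?E \<subseteq> carrier G" using F by auto
    have T0W: "T0 <#> S \<subseteq> W"
      using TW mono_set_mult[of T0 T0' S S] by (auto simp: T_def T0'_def)
    have "2 * card (set_inv T0 <#> ?E) \<le> f + 2 * card ((S <#> F) - F) + 2 * card ((set_inv T0 <#> F) - F)"
      unfolding f_def using S T0 T0W F C g cover by (intro card_touching_uncovered_le)
    then have "real (card (set_inv T0 <#> ?E)) \<le> (1 / 2 + 2 * \<eta>) * f"
      using kF(3,4) by (simp add: algebra_simps)
    then have "a * real (card (set_inv T0 <#> ?E)) \<le> a * ((1 / 2 + 2 * \<eta>) * f)"
      using a by (intro mult_left_mono) auto
    with log_block_count_le[OF Z(1,3) T0 E a(2)]
    have E': "log 2 (block_count ?E Z) \<le> a * ((1 / 2 + 2 * \<eta>) * f)" by linarith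
    have pos: "real (block_count ?E Z) > 0" using symbolic_system_block_count_pos[OF Z(1) E Z(3)] by simp
    have "real (card \<Lambda>) ^ card ?B * real (block_count ?E Z)
      = 2 powr (real (card ?B) * l) * 2 powr (log 2 (block_count ?E Z))"
      using pos by (simp add: powl powr_power mult.commute)
    also have "\<dots> = 2 powr (real (card ?B) * l + log 2 (block_count ?E Z))" by (simp add: powr_add)
    also have "\<dots> \<le> K" unfolding K_def using B E' by (intro powr_mono) (auto simp: algebra_simps)
    finally show ?thesis .
  qed

  define lab where "lab = (\<lambda>g. \<lambda>u\<in>F'. if u \<otimes> g \<in> C then Suc (col (u \<otimes> g)) else 0)"
  have orbit: "real (block_count F {shift G g x | g. g \<in> carrier G}) \<le> real (card (lab ` carrier G)) * K"
    unfolding lab_def F'_def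
    by (rule orbit_block_count_le[OF X x Z(1) z C colq W TW F(1,2) out tile K])
  have labels: "real (card (lab ` carrier G)) \<le> (1 + 1 / s) ^ card F' * (real q * s) ^ m"
  proof (rule card_sparse_labellings[OF F'(1)])
    show "lab ` carrier G \<subseteq> F' \<rightarrow>\<^sub>E {..q}" using colq by (auto simp: lab_def Suc_le_eq)
    show "card {u \<in> F'. \<sigma> u \<noteq> 0} \<le> m" if \<sigma>: "\<sigma> \<in> lab ` carrier G" for \<sigma>
    proof -
      from \<sigma> obtain g where g: "g \<in> carrier G" "\<sigma> = lab g" by blast
      have "card {u \<in> F'. \<sigma> u \<noteq> 0} \<le> card (C \<inter> (F' #> g))"
      proof (rule card_inj_on_le[of "\<lambda>u. u \<otimes> g"])
        show "inj_on (\<lambda>u. u \<otimes> g) {u \<in> F'. \<sigma> u \<noteq> 0}"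
          using F' g by (intro inj_onI) (auto simp: subset_iff)
        show "(\<lambda>u. u \<otimes> g) ` {u \<in> F'. \<sigma> u \<noteq> 0} \<subseteq> C \<inter> (F' #> g)"
          unfolding g(2) lab_def by (auto simp: r_coset_def split: if_splits)
      qed (use F' in \<open>simp add: r_coset_def\<close>)
      then show ?thesis using few[OF g(1)] by linarith
    qed
  qed (use S in \<open>auto simp: q_def\<close>)
  have cost: "real (card F') * log 2 (1 + 1 / s) + m * log 2 (real q * s) \<le> a / 8 * f"
  proof -
    have s1: "real s \<ge> 1" using S(4) by simp
    have "real (card F') * log 2 (1 + 1 / s) \<le> real (2 * f) * (2 * (1 / s))"
    proof (intro mult_mono of_nat_mono kF(2))
      show "log 2 (1 + 1 / s) \<le> 2 * (1 / s)" using log2_one_plus_le[of "1 / s"] by simp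
      show "0 \<le> log 2 (1 + 1 / s)"
        unfolding log_def using s1 by (intro divide_nonneg_nonneg ln_ge_zero) auto
    qed simp
    moreover have "real m * log 2 (real q * s) \<le> (4 * f / s) * log 2 (9 * real s ^ 3)"
    proof (rule mult_mono)
      show "real m \<le> 4 * f / s"
        using ms s1 by (simp add: pos_le_divide_eq flip: of_nat_mult)
      have qs: "1 * 1 \<le> real q * s" using s1 by (intro mult_mono) (auto simp: q_def)
      have "1 \<le> real s ^ 2" using s1 by simp
      then have "real q * s \<le> (9 * real s ^ 2) * s" unfolding q_def by (intro mult_right_mono) auto
      also have "\<dots> = 9 * real s ^ 3" by (simp add: power2_eq_square power3_eq_cube)
      finally show "log 2 (real q * s) \<le> log 2 (9 * real s ^ 3)"
        using qs s1 by (subst log_le_cancel_iff) auto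
      show "0 \<le> log 2 (real q * s)" using qs by simp
    qed simp
    moreover have "real (2 * f) * (2 * (1 / s)) + (4 * f / s) * log 2 (9 * real s ^ 3)
      = (4 / s + 4 / s * log 2 (9 * real s ^ 3)) * f" by (simp add: field_simps)
    moreover have "\<dots> \<le> a / 8 * f" using s0[OF s(3)] by (intro mult_right_mono) auto
    ultimately show ?thesis by linarith
  qed
  obtain Z' where Z': "symbolic_system G \<Lambda> Z'" "Z' \<subseteq> X" "Z' \<noteq> {}"
    "block_count F Z' \<le> block_count F {shift G g x | g. g \<in> carrier G}"
    using subsystem_with_window_blocks[OF X x F(1,2)] by blast
  have s1: "real s \<ge> 1" "real q \<ge> 1" using S(4) by (auto simp: q_def)
  have "real (block_count F Z') \<le> real (card (lab ` carrier G)) * K"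
    using Z'(4) orbit by linarith
  also have "\<dots> \<le> (1 + 1 / s) ^ card F' * (real q * s) ^ m * K"
    using labels by (intro mult_right_mono) (auto simp: K_def)
  also have "(1 + 1 / real s) ^ card F' = 2 powr (real (card F') * log 2 (1 + 1 / s))"
  proof -
    have "(1 + 1 / real s) = 2 powr log 2 (1 + 1 / s)" using s1 by (intro powr_log_cancel[symmetric]) (auto intro: add_pos_nonneg)
    then show ?thesis by (metis powr_power mult.commute zero_neq_numeral)
  qed
  also have "(real q * s) ^ m = 2 powr (m * log 2 (real q * s))"
  proof -
    have "real q * s = 2 powr log 2 (real q * s)" using s1 by (intro powr_log_cancel[symmetric]) auto
    then show ?thesis by (metis powr_power mult.commute zero_neq_numeral)
  qed
  finally have "real (block_count F Z') \<le> 2 powr (real (card F') * log 2 (1 + 1 / s) + m * log 2 (real q * s)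
      + (4 * \<eta> * l + 2 * \<eta> * a + a / 2) * f)"
    by (simp add: K_def powr_add)
  moreover have pos: "real (block_count F Z') > 0"
    using symbolic_system_block_count_pos[OF Z'(1) F(1,2) Z'(3)] by simp
  ultimately have "log 2 (block_count F Z') \<le> real (card F') * log 2 (1 + 1 / s) + m * log 2 (real q * s)
      + (4 * \<eta> * l + 2 * \<eta> * a + a / 2) * f"
    by (simp add: log_le_iff)
  also have "\<dots> \<le> a / 8 * f + (a / 8 + a / 2) * f"
    using cost \<eta>_small by (intro add_mono mult_right_mono) auto
  also have "\<dots> = (3 / 4 * a) * f" by (simp add: algebra_simps)
  finally have "log 2 (block_count F Z') \<le> (3 / 4 * a) * card F" by (simp add: f_def)
  then show ?thesis using Z' F by blast
qed

text \<open>
  Iterating the previous step makes the entropy arbitrarily small. The iteration starts with \<open>X\<close> and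
  the one-point window.
\<close>
lemma low_entropy_subsystem:
  assumes am: "amenable G" and inf: "infinite (carrier G)" and count: "countable (carrier G)"
    and X: "symbolic_system G \<Lambda> X" "X \<noteq> {}" and D: "gluing_set G D X" and \<delta>: "\<delta> > (0::real)"
  shows "\<exists>Z T. symbolic_system G \<Lambda> Z \<and> Z \<subseteq> X \<and> Z \<noteq> {} \<and>
    finite T \<and> T \<subseteq> carrier G \<and> T \<noteq> {} \<and> log 2 (block_count T Z) \<le> \<delta> * card T"
proof -
  define a0 where "a0 = log 2 (block_count {\<one>} X) + 1"
  have "real (block_count {\<one>} X) \<ge> 1"
    using symbolic_system_block_count_pos[OF X(1) _ _ X(2), of "{\<one>}"] by simp
  then have a0: "a0 > 0" by (simp add: a0_def add_nonneg_pos)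
  have step: "\<exists>Z T. symbolic_system G \<Lambda> Z \<and> Z \<subseteq> X \<and> Z \<noteq> {} \<and>
    finite T \<and> T \<subseteq> carrier G \<and> T \<noteq> {} \<and> log 2 (block_count T Z) \<le> ((3 / 4) ^ n * a0) * card T" for n
  proof (induction n)
    case 0
    have "log 2 (block_count {\<one>} X) \<le> ((3 / 4) ^ 0 * a0) * card {\<one>}" by (simp add: a0_def)
    moreover have "finite {\<one>}" "{\<one>} \<subseteq> carrier G" "{\<one>} \<noteq> {}" by auto
    ultimately show ?case using X by blast
  next
    case (Suc n)
    then obtain Z T where Z: "symbolic_system G \<Lambda> Z" "Z \<subseteq> X" "Z \<noteq> {}"
      and T: "finite T" "T \<subseteq> carrier G" "T \<noteq> {}" "log 2 (block_count T Z) \<le> ((3 / 4) ^ n * a0) * card T"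
      by blast
    have "(3 / 4) ^ n * a0 > 0" using a0 by simp
    from low_entropy_step[OF am inf count X(1) D Z T(1-3) this T(4)]
    show ?case by (simp add: mult.assoc)
  qed
  have "(\<lambda>n. (3 / 4) ^ n * a0) \<longlonglongrightarrow> 0 * a0" by (intro tendsto_intros LIMSEQ_realpow_zero) auto
  then have "\<forall>\<^sub>F n in sequentially. (3 / 4) ^ n * a0 < \<delta>" using \<delta> by (intro order_tendstoD(2)) auto
  then obtain n where n: "(3 / 4) ^ n * a0 \<le> \<delta>" by (auto simp: eventually_sequentially intro: less_imp_le)
  obtain Z T where ZT: "symbolic_system G \<Lambda> Z" "Z \<subseteq> X" "Z \<noteq> {}" "finite T" "T \<subseteq> carrier G" "T \<noteq> {}"
    "log 2 (block_count T Z) \<le> ((3 / 4) ^ n * a0) * card T" using step[of n] by blast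
  have "log 2 (block_count T Z) \<le> \<delta> * card T"
    using ZT(7) mult_right_mono[OF n, of "real (card T)"] by simp
  then show ?thesis using ZT by blast
qed

end

section \<open>The tagged union\<close>

definition letterwise :: "('g, 'm) monoid_scheme \<Rightarrow> ('a \<Rightarrow> 'b) \<Rightarrow> ('g \<Rightarrow> 'a) \<Rightarrow> 'g \<Rightarrow> 'b" where
  "letterwise G \<phi> y = (\<lambda>g\<in>carrier G. \<phi> (y g))"

lemma letterwise_full_shift:
  "\<phi> \<in> \<Lambda> \<rightarrow> \<Delta> \<Longrightarrow> y \<in> full_shift G \<Lambda> \<Longrightarrow> letterwise G \<phi> y \<in> full_shift G \<Delta>"
  by (auto simp: letterwise_def full_shift_def)

lemma continuous_map_letterwise:
  assumes "\<phi> \<in> \<Lambda> \<rightarrow> \<Delta>"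
  shows "continuous_map (shift_topology G \<Lambda>) (shift_topology G \<Delta>) (letterwise G \<phi>)"
  unfolding shift_topology_def continuous_map_componentwise
proof (intro conjI ballI)
  fix g assume g: "g \<in> carrier G"
  have "continuous_map (product_topology (\<lambda>_. discrete_topology \<Lambda>) (carrier G)) (discrete_topology \<Delta>)
      (\<phi> \<circ> (\<lambda>y. y g))"
    using g assms
    by (intro continuous_map_compose[OF continuous_map_product_projection]) auto
  then show "continuous_map (product_topology (\<lambda>_. discrete_topology \<Lambda>) (carrier G)) (discrete_topology \<Delta>)
      (\<lambda>y. letterwise G \<phi> y g)"
    using g by (simp add: letterwise_def comp_def)
qed (auto simp: letterwise_def)

lemma factors_onto_letterwise:
  assumes "\<phi> \<in> \<Lambda> \<rightarrow> \<Delta>" "letterwise G \<phi> ` Y = Z" "group G"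
  shows "factors_onto G \<Lambda> Y \<Delta> Z"
  unfolding factors_onto_def
proof (intro exI[of _ "letterwise G \<phi>"] conjI ballI)
  interpret group G by fact
  show "continuous_map (subtopology (shift_topology G \<Lambda>) Y) (subtopology (shift_topology G \<Delta>) Z) (letterwise G \<phi>)"
    using assms(2) continuous_map_letterwise[OF assms(1)]
    by (auto simp: continuous_map_in_subtopology intro: continuous_map_from_subtopology)
  show "letterwise G \<phi> (shift G g y) = shift G g (letterwise G \<phi> y)" if "g \<in> carrier G" for g y
    using that by (auto simp: letterwise_def shift_def)
qed (rule assms(2))

lemma closedin_letterwise_preimage:
  assumes "\<phi> \<in> \<Lambda> \<rightarrow> \<Delta>" "closedin (shift_topology G \<Delta>) Z"
  shows "closedin (shift_topology G \<Lambda>) {y \<in> full_shift G \<Lambda>. letterwise G \<phi> y \<in> Z}"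
  using closedin_continuous_map_preimage[OF continuous_map_letterwise[OF assms(1)] assms(2)]
  by (simp add: topspace_shift_topology)

lemma closedin_full_shift: "\<Delta> \<subseteq> \<Lambda> \<Longrightarrow> closedin (shift_topology G \<Lambda>) (full_shift G \<Delta>)"
  by (auto simp: shift_topology_def full_shift_def closedin_product_topology)

lemma shift_full_shift: "group G \<Longrightarrow> g \<in> carrier G \<Longrightarrow> y \<in> full_shift G \<Lambda> \<Longrightarrow> shift G g y \<in> full_shift G \<Lambda>"
  by (auto simp: shift_def full_shift_def group.is_monoid monoid.m_closed intro!: PiE_I)

lemma letterwise_shift:
  "group G \<Longrightarrow> g \<in> carrier G \<Longrightarrow> letterwise G \<phi> (shift G g y) = shift G g (letterwise G \<phi> y)"
  by (auto simp: letterwise_def shift_def group.is_monoid monoid.m_closed)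

lemma block_count_letterwise_le:
  assumes "T \<subseteq> carrier G" "finite (occurring_blocks T Y)"
  shows "block_count T (letterwise G \<phi> ` Y) \<le> block_count T Y"
proof -
  have "restrict (letterwise G \<phi> y) T = (\<lambda>v\<in>T. \<phi> (restrict y T v))" for y
    using assms(1) by (auto simp: letterwise_def fun_eq_iff)
  then have "occurring_blocks T (letterwise G \<phi> ` Y) = (\<lambda>b. \<lambda>v\<in>T. \<phi> (b v)) ` occurring_blocks T Y"
    by (simp add: occurring_blocks_def image_image)
  then show ?thesis using assms(2) by (simp add: card_image_le)
qed

text \<open>
  The system \<open>X'\<close> is the disjoint union of \<open>X\<close> and of the product of \<open>Z\<close> with the full shift over
  \<open>{1..k}\<close>. A symbol of \<open>X'\<close> encodes a letter of \<open>\<Lambda>\<close> and a tag, which is constantly \<open>0\<close> on the copy of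
  \<open>X\<close> and is the full shift coordinate on the product. Both factor maps work symbol by symbol: reading
  the letter maps \<open>X'\<close> onto \<open>X\<close> because \<open>Z\<close> is contained in \<open>X\<close>; reading the tag, with \<open>0\<close> replaced by
  \<open>1\<close>, maps \<open>X'\<close> onto the full shift because \<open>Z\<close> is nonempty.
\<close>
lemma tagged_union:
  fixes G :: "('g, 'm) monoid_scheme" and \<Lambda> :: "'a set"
  assumes G: "group G" and k: "k > 0"
    and X: "symbolic_system G \<Lambda> X" and Z: "symbolic_system G \<Lambda> Z" "Z \<subseteq> X" "Z \<noteq> {}"
  obtains \<Lambda>' :: "nat set" and X' :: "('g \<Rightarrow> nat) set" where
    "symbolic_system G \<Lambda>' X'" "factors_onto G \<Lambda>' X' \<Lambda> X"
    "factors_onto G \<Lambda>' X' {1..k} (full_shift G {1..k})"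
    "\<And>F. finite F \<Longrightarrow> F \<subseteq> carrier G \<Longrightarrow> block_count F X \<le> block_count F X'"
    "\<And>F. finite F \<Longrightarrow> F \<subseteq> carrier G \<Longrightarrow> block_count F X' \<le> block_count F X + block_count F Z * k ^ card F"
proof -
  interpret group G by fact
  note XD = symbolic_systemD[OF X] and ZD = symbolic_systemD[OF Z(1)]
  have cnt: "countable \<Lambda>" using XD(1) by (rule countable_finite)
  define enc where "enc a i = prod_encode (to_nat_on \<Lambda> a, i)" for a :: 'a and i :: nat
  define letter where "letter n = from_nat_into \<Lambda> (fst (prod_decode n))" for n
  define tag where "tag n = snd (prod_decode n)" for n
  define \<Lambda>' where "\<Lambda>' = (\<lambda>(a, i). enc a i) ` (\<Lambda> \<times> {0..k})"
  have dec: "letter (enc a i) = a" "tag (enc a i) = i" if "a \<in> \<Lambda>" for a i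
    using cnt that by (simp_all add: enc_def letter_def tag_def)
  have maps: "letter \<in> \<Lambda>' \<rightarrow> \<Lambda>" "tag \<in> \<Lambda>' \<rightarrow> {0..k}" "(\<lambda>n. max 1 (tag n)) \<in> \<Lambda>' \<rightarrow> {1..k}"
    using k by (auto simp: \<Lambda>'_def dec)
  have enc_dec: "enc (letter n) (tag n) = n" if "n \<in> \<Lambda>'" for n
    using that by (auto simp: \<Lambda>'_def dec)
  define join where "join x w = (\<lambda>g\<in>carrier G. enc (x g) (w g))" for x w
  have join: "join x w \<in> full_shift G \<Lambda>'" "letterwise G letter (join x w) = x" "letterwise G tag (join x w) = w"
    if "x \<in> full_shift G \<Lambda>" "w \<in> full_shift G {0..k}" for x w
  proof -
    have mem: "x g \<in> \<Lambda>" "w g \<in> {0..k}" if "g \<in> carrier G" for g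
      using \<open>x \<in> full_shift G \<Lambda>\<close> \<open>w \<in> full_shift G {0..k}\<close> that by (auto simp: full_shift_def)
    have ext: "x \<in> extensional (carrier G)" "w \<in> extensional (carrier G)"
      using that by (auto simp: full_shift_def PiE_iff)
    have "enc (x g) (w g) \<in> \<Lambda>'" if "g \<in> carrier G" for g
      unfolding \<Lambda>'_def using mem[OF that] by (intro image_eqI[of _ _ "(x g, w g)"]) auto
    then show "join x w \<in> full_shift G \<Lambda>'" by (auto simp: join_def full_shift_def)
    show "letterwise G letter (join x w) = x" "letterwise G tag (join x w) = w"
      using ext mem by (auto simp: letterwise_def join_def dec intro!: extensionalityI[of _ "carrier G"])
  qed
  define X1 where "X1 = {y \<in> full_shift G \<Lambda>'. letterwise G letter y \<in> X} \<inter>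
    {y \<in> full_shift G \<Lambda>'. letterwise G tag y \<in> full_shift G {0}}"
  define X2 where "X2 = {y \<in> full_shift G \<Lambda>'. letterwise G letter y \<in> Z} \<inter>
    {y \<in> full_shift G \<Lambda>'. letterwise G tag y \<in> full_shift G {1..k}}"
  define X' where "X' = X1 \<union> X2"
  have "closedin (shift_topology G \<Lambda>') X'"
    unfolding X'_def X1_def X2_def using k
    by (intro closedin_Un closedin_Int closedin_letterwise_preimage[OF maps(1)]
        closedin_letterwise_preimage[OF maps(2)] closedin_full_shift XD(2) ZD(2)) auto
  moreover have "shift G g y \<in> X'" if "g \<in> carrier G" "y \<in> X'" for g y
    using that XD(4)[of g] ZD(4)[of g] shift_full_shift[OF G, of g]
    by (auto simp: X'_def X1_def X2_def letterwise_shift[OF G])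
  moreover have "finite \<Lambda>'" using XD(1) by (simp add: \<Lambda>'_def)
  ultimately have sys: "symbolic_system G \<Lambda>' X'" by (simp add: symbolic_system_def)
  have zero: "(\<lambda>g\<in>carrier G. 0 :: nat) \<in> full_shift G {0}" "full_shift G {0} \<subseteq> full_shift G {0..k}"
    "full_shift G {1..k} \<subseteq> full_shift G {0..k}"
    unfolding full_shift_def by (auto intro!: PiE_mono)
  have imX: "letterwise G letter ` X' = X"
  proof
    show "letterwise G letter ` X' \<subseteq> X" using Z(2) by (auto simp: X'_def X1_def X2_def)
    show "X \<subseteq> letterwise G letter ` X'"
    proof
      fix x assume x: "x \<in> X"
      let ?y = "join x (\<lambda>g\<in>carrier G. 0)"
      note j = join[OF subsetD[OF XD(3) x] subsetD[OF zero(2,1)]]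
      then have "?y \<in> X'" using x zero by (simp add: X'_def X1_def)
      then show "x \<in> letterwise G letter ` X'" using j(2) by force
    qed
  qed
  have imF: "letterwise G (\<lambda>n. max 1 (tag n)) ` X' = full_shift G {1..k}"
  proof
    show "letterwise G (\<lambda>n. max 1 (tag n)) ` X' \<subseteq> full_shift G {1..k}"
      using letterwise_full_shift[OF maps(3)] by (auto simp: X'_def X1_def X2_def)
    show "full_shift G {1..k} \<subseteq> letterwise G (\<lambda>n. max 1 (tag n)) ` X'"
    proof
      fix w assume w: "w \<in> full_shift G {1..k}"
      obtain z where z: "z \<in> Z" using Z(3) by blast
      note j = join[OF subsetD[OF ZD(3) z] subsetD[OF zero(3) w]]
      then have "join z w \<in> X'" using z w by (simp add: X'_def X2_def)
      moreover have "letterwise G (\<lambda>n. max 1 (tag n)) (join z w) = w"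
      proof -
        have "letterwise G (\<lambda>n. max 1 (tag n)) (join z w) = (\<lambda>g\<in>carrier G. max 1 (letterwise G tag (join z w) g))"
          by (auto simp: letterwise_def)
        also have "\<dots> = w" unfolding j(3)
          using w by (intro extensionalityI[of _ "carrier G"]) (auto simp: full_shift_def PiE_iff max_def)
        finally show ?thesis .
      qed
      ultimately show "w \<in> letterwise G (\<lambda>n. max 1 (tag n)) ` X'" by force
    qed
  qed
  show ?thesis
  proof (rule that[OF sys factors_onto_letterwise[OF maps(1) imX G] factors_onto_letterwise[OF maps(3) imF G]])
    fix F assume F: "finite F" "F \<subseteq> carrier G"
    have "block_count F (letterwise G letter ` X') \<le> block_count F X'"
      using symbolic_system_finite_blocks[OF sys F] F by (intro block_count_letterwise_le) auto
    then show "block_count F X \<le> block_count F X'" by (simp add: imX)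
    have decode: "y v = enc (letterwise G letter y v) (letterwise G tag y v)"
      if "y \<in> full_shift G \<Lambda>'" "v \<in> F" for y v
      using that F enc_dec[of "y v"] by (auto simp: letterwise_def full_shift_def PiE_iff subset_iff)
    have "occurring_blocks F X1 \<subseteq> (\<lambda>b. \<lambda>v\<in>F. enc (b v) 0) ` occurring_blocks F X"
    proof
      fix b assume "b \<in> occurring_blocks F X1"
      then obtain y where y: "y \<in> full_shift G \<Lambda>'" "letterwise G letter y \<in> X"
        "letterwise G tag y \<in> full_shift G {0}" "b = restrict y F"
        by (auto simp: occurring_blocks_def X1_def)
      have "b = (\<lambda>v\<in>F. enc (restrict (letterwise G letter y) F v) 0)"
        unfolding y(4)
      proof (rule restrict_ext)
        fix v assume v: "v \<in> F"
        then have "letterwise G tag y v = 0" using y(3) F by (auto simp: full_shift_def)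
        then show "y v = enc (restrict (letterwise G letter y) F v) 0" using decode[OF y(1) v] v by simp
      qed
      then show "b \<in> (\<lambda>b. \<lambda>v\<in>F. enc (b v) 0) ` occurring_blocks F X"
        using y(2) unfolding occurring_blocks_def by blast
    qed
    then have 1: "block_count F X1 \<le> block_count F X"
      using symbolic_system_finite_blocks[OF X F] by (rule surj_card_le[rotated])
    have "occurring_blocks F X2 \<subseteq> (\<lambda>(b, w). \<lambda>v\<in>F. enc (b v) (w v)) ` (occurring_blocks F Z \<times> (F \<rightarrow>\<^sub>E {1..k}))"
    proof
      fix b assume "b \<in> occurring_blocks F X2"
      then obtain y where y: "y \<in> full_shift G \<Lambda>'" "letterwise G letter y \<in> Z"
        "letterwise G tag y \<in> full_shift G {1..k}" "b = restrict y F"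
        by (auto simp: occurring_blocks_def X2_def)
      let ?p = "(restrict (letterwise G letter y) F, restrict (letterwise G tag y) F)"
      have "b = (\<lambda>(b, w). \<lambda>v\<in>F. enc (b v) (w v)) ?p"
        unfolding y(4) prod.case by (rule restrict_ext) (use decode[OF y(1)] in simp)
      moreover have "?p \<in> occurring_blocks F Z \<times> (F \<rightarrow>\<^sub>E {1..k})"
        using y(2,3) F by (auto simp: occurring_blocks_def full_shift_def)
      ultimately show "b \<in> (\<lambda>(b, w). \<lambda>v\<in>F. enc (b v) (w v)) ` (occurring_blocks F Z \<times> (F \<rightarrow>\<^sub>E {1..k}))"
        by (rule image_eqI)
    qed
    moreover have "finite (occurring_blocks F Z \<times> (F \<rightarrow>\<^sub>E {1..k}))"
      using symbolic_system_finite_blocks[OF Z(1) F] F by (intro finite_cartesian_product finite_PiE) auto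
    ultimately have "block_count F X2 \<le> card (occurring_blocks F Z \<times> (F \<rightarrow>\<^sub>E {1..k}))"
      by (rule surj_card_le[rotated])
    then have 2: "block_count F X2 \<le> block_count F Z * k ^ card F"
      using F by (simp add: card_cartesian_product card_PiE)
    have "occurring_blocks F X' = occurring_blocks F X1 \<union> occurring_blocks F X2"
      by (auto simp: occurring_blocks_def X'_def)
    then have "block_count F X' \<le> block_count F X1 + block_count F X2" by (simp add: card_Un_le)
    then show "block_count F X' \<le> block_count F X + block_count F Z * k ^ card F" using 1 2 by linarith
  qed
qed

theorem theorem5p2:
  fixes G :: "('g, 'm) monoid_scheme" and k :: nat
    and \<Lambda> :: "'a set" and X :: "('g \<Rightarrow> 'a) set"
  assumes "group G" and "countable (carrier G)" and "infinite (carrier G)" and "amenable G"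
    and "k > 0"
    and "symbolic_system G \<Lambda> X"
    and "entropy G X > log 2 (real k)"
    and "gluing_property G X"
  shows "\<exists>(\<Lambda>' :: nat set) (X' :: ('g \<Rightarrow> nat) set).
           symbolic_system G \<Lambda>' X' \<and>
           factors_onto G \<Lambda>' X' \<Lambda> X \<and>
           entropy G X' = entropy G X \<and>
           factors_onto G \<Lambda>' X' {1..k} (full_shift G {1..k})"
proof -
  interpret group G by fact
  note am = \<open>amenable G\<close> and X = \<open>symbolic_system G \<Lambda> X\<close>
  define h where "h = entropy G X"
  define \<delta> where "\<delta> = (h - log 2 (real k)) / 3"
  have \<delta>: "\<delta> > 0" using assms(7) by (simp add: \<delta>_def h_def)
  have logk: "log 2 (real k) \<ge> 0" using \<open>k > 0\<close> by simp
  have ne: "X \<noteq> {}"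
  proof
    assume "X = {}"
    then have "entropy G X = 0"
      by (intro entropy_eqI[OF am]) (simp add: occurring_blocks_def log_def)
    then show False using assms(7) logk by simp
  qed
  obtain D where D: "gluing_set G D X" using assms(8) gluing_property_iff by blast
  obtain Z T where Z: "symbolic_system G \<Lambda> Z" "Z \<subseteq> X" "Z \<noteq> {}"
    and T: "finite T" "T \<subseteq> carrier G" "T \<noteq> {}" "log 2 (block_count T Z) \<le> \<delta> / 2 * card T"
    using low_entropy_subsystem[OF am assms(3,2) X ne D, of "\<delta> / 2"] \<delta> by auto
  obtain \<Lambda>' :: "nat set" and X' :: "('g \<Rightarrow> nat) set" where
    X': "symbolic_system G \<Lambda>' X'" "factors_onto G \<Lambda>' X' \<Lambda> X"
    "factors_onto G \<Lambda>' X' {1..k} (full_shift G {1..k})"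
    and lower: "\<And>F. finite F \<Longrightarrow> F \<subseteq> carrier G \<Longrightarrow> block_count F X \<le> block_count F X'"
    and upper: "\<And>F. finite F \<Longrightarrow> F \<subseteq> carrier G \<Longrightarrow> block_count F X' \<le> block_count F X + block_count F Z * k ^ card F"
    using tagged_union[OF assms(1) \<open>k > 0\<close> X Z] by blast
  have "entropy G X' = h"
  proof (rule entropy_eqI[OF am])
    fix F assume F: "folner_sequence G F"
    note FD = folner_sequenceD[OF F]
    have lim: "(\<lambda>n. log 2 (block_count (F n) X) / card (F n)) \<longlonglongrightarrow> h"
      unfolding h_def by (rule entropy_tendsto[OF am X ne F])
    have inv: "filterlim (\<lambda>n. real (card (F n))) at_infinity sequentially"
      using filterlim_compose[OF filterlim_real_sequentially folner_card_at_top[OF F assms(3)]]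
      by (rule filterlim_at_top_imp_at_infinity)
    have lim': "(\<lambda>n. log 2 (block_count (F n) X) / card (F n) + 1 / card (F n)) \<longlonglongrightarrow> h + 0"
      by (intro tendsto_add lim tendsto_divide_0[OF tendsto_const inv])
    have pos: "real (block_count (F n) X) > 0" "real (block_count (F n) Z) > 0" "real (card (F n)) > 0" for n
      using symbolic_system_block_count_pos[OF X _ _ ne] symbolic_system_block_count_pos[OF Z(1) _ _ Z(3)] FD
      by auto
    have pos': "real (block_count (F n) X') > 0" for n using pos(1)[of n] lower[of "F n"] FD by simp
    \<comment> \<open>On large Folner sets the product of \<open>Z\<close> with the full shift has at most as many blocks as \<open>X\<close>,
      so passing from \<open>X\<close> to \<open>X'\<close> adds at most one bit.\<close>
    have "\<forall>\<^sub>F n in sequentially. h - \<delta> < log 2 (block_count (F n) X) / card (F n)"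
      using \<delta> by (intro order_tendstoD(1)[OF lim]) simp
    moreover have "\<forall>\<^sub>F n in sequentially. real (card ((set_inv\<^bsub>G\<^esub> T <#>\<^bsub>G\<^esub> F n) - F n)) \<le> (1::real) * card (F n) \<and>
        real (card (set_inv\<^bsub>G\<^esub> T <#>\<^bsub>G\<^esub> F n)) \<le> (1 + 1 :: real) * card (F n)"
      using T by (intro folner_eventually_invariant[OF F] finite_set_inv set_inv_closed) auto
    ultimately have up: "\<forall>\<^sub>F n in sequentially. log 2 (block_count (F n) X') / card (F n)
        \<le> log 2 (block_count (F n) X) / card (F n) + 1 / card (F n)"
    proof eventually_elim
      case (elim n)
      have "log 2 (block_count (F n) Z) \<le> \<delta> / 2 * card (set_inv\<^bsub>G\<^esub> T <#>\<^bsub>G\<^esub> F n)"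
        by (rule log_block_count_le[OF Z(1,3) T(1-3) FD(2,1) T(4)])
      also have "\<dots> \<le> \<delta> / 2 * (2 * card (F n))" using elim(2) \<delta> by (intro mult_left_mono) auto
      finally have "log 2 (block_count (F n) Z) \<le> \<delta> * card (F n)" by simp
      then have "log 2 (real (block_count (F n) Z) * real k ^ card (F n)) \<le> (\<delta> + log 2 k) * card (F n)"
        using pos \<open>k > 0\<close> by (simp add: log_mult log_nat_power algebra_simps)
      also have "\<dots> \<le> (h - \<delta>) * card (F n)"
      proof (rule mult_right_mono)
        have "h = log 2 (real k) + 3 * \<delta>" by (simp add: \<delta>_def field_simps)
        then show "\<delta> + log 2 k \<le> h - \<delta>" using \<delta> by linarith
      qed simp
      also have "\<dots> \<le> log 2 (block_count (F n) X)" using elim(1) pos by (simp add: pos_less_divide_eq)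
      finally have "real (block_count (F n) Z) * real k ^ card (F n) \<le> real (block_count (F n) X)"
        using pos \<open>k > 0\<close> by (simp add: log_le_cancel_iff)
      moreover have "real (block_count (F n) X') \<le> real (block_count (F n) X + block_count (F n) Z * k ^ card (F n))"
        by (intro of_nat_mono upper FD)
      ultimately have "real (block_count (F n) X') \<le> 2 * real (block_count (F n) X)" by simp
      then have "log 2 (block_count (F n) X') \<le> log 2 (2 * real (block_count (F n) X))"
        using pos pos' by (subst log_le_cancel_iff) auto
      also have "\<dots> = 1 + log 2 (block_count (F n) X)" using pos by (simp add: log_mult)
      finally show ?case using pos by (simp add: divide_right_mono flip: add_divide_distrib)
    qed
    show "(\<lambda>n. log 2 (block_count (F n) X') / card (F n)) \<longlonglongrightarrow> h"
    proof (rule tendsto_sandwich[OF _ up lim])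
      show "\<forall>\<^sub>F n in sequentially. log 2 (block_count (F n) X) / card (F n) \<le> log 2 (block_count (F n) X') / card (F n)"
      proof (intro always_eventually allI divide_right_mono)
        show "log 2 (block_count (F n) X) \<le> log 2 (block_count (F n) X')" for n
          using pos pos' lower[OF FD(2,1)] by (subst log_le_cancel_iff) auto
      qed simp
      show "(\<lambda>n. log 2 (block_count (F n) X) / card (F n) + 1 / card (F n)) \<longlonglongrightarrow> h" using lim' by simp
    qed
  qed
  then show ?thesis using X' by (auto simp: h_def)
qed

end
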